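(* Let $(\mathbf w^k)_{k\ge 0}$, $\mathbf w^k=(\mathbf x_1^k,\dots,\mathbf x_l^k;\mathbf z^k)$, be any sequence generated by the Prox-IADMM iteration (described in the context) with penalty parameter $\beta>0$, regularization matrices $\mathbf H_1,\dots,\mathbf H_l$ and step sizes $\alpha_k$, $k\ge 0$. Assume that the set $\mathcal W^*$ of KKT points is nonempty, that there is $\alpha\in[0,1)$ with $0\le\alpha_k\le\alpha$ for all $k\ge 0$ and $$\sum_{k=1}^\infty \alpha_k\|\mathbf w^k-\mathbf w^{k-1}\|_{\mathbf G}^2<\infty,$$ and that $$\mathbf H_1\succ \mathbf 0\quad\text{and}\quad \mathbf H_j\succ \beta(l-2)\mathbf A_j^T\mathbf A_j,\quad 2\le j\le l.$$ Then the following hold. (i) $\displaystyle\lim_{k\to\infty}\sum_{j=1}^l\mathbf A_j\mathbf x_j^k=\mathbf c$. (ii) $\displaystyle\lim_{k\to\infty}\sum_{j=1}^l f_j(\mathbf x_j^k)=\min\Big\{\sum_{j=1}^l f_j(\mathbf x_j):\ \mathbf x_j\in\mathcal X^j\ (1\le j\le l),\ \sum_{j=1}^l\mathbf A_j\mathbf x_j=\mathbf c\Big\}$. (iii) The sequence $\mathbf w^k$ converges to a KKT point: there is $\mathbf w^*\in\mathcal W^*$ with $\lim_{k\to\infty}\mathbf w^k=\mathbf w^*$.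
   Context: Problem. Let $l\ge 2$, $\mathbf A_j\in\mathbb R^{m\times n_j}$, $\mathbf c\in\mathbb R^m$, $\mathcal X^j\subset\mathbb R^{n_j}$ closed convex sets, and $f_j:\mathbb R^{n_j}\to(-\infty,\infty)$ closed convex functions, $1\le j\le l$. The problem is to minimize $\sum_{j=1}^l f_j(\mathbf x_j)$ over $\mathbf x_j\in\mathcal X^j$ subject to $\sum_{j=1}^l\mathbf A_j\mathbf x_j=\mathbf c$. Put $n=\sum_j n_j$, $\mathcal W=\mathcal X^1\times\cdots\times\mathcal X^l\times\mathbb R^m\subset\mathbb R^{n+m}$, and write $\mathbf w=(\mathbf x_1,\dots,\mathbf x_l;\mathbf z)\in\mathcal W$ (a column vector), $\theta(\mathbf w)=\sum_{j=1}^l f_j(\mathbf x_j)$, and $$F(\mathbf w)=\Big(-\mathbf A_1^T\mathbf z,\dots,-\mathbf A_l^T\mathbf z;\ \sum_{j=1}^l\mathbf A_j\mathbf x_j-\mathbf c\Big).$$ KKT points. $\mathcal W^*$ is the set of $\mathbf w^*\in\mathcal W$ such that $\theta(\mathbf w)-\theta(\mathbf w^* )+\langle\mathbf w-\mathbf w^*,F(\mathbf w^* )\rangle\ge 0$ for all $\mathbf w\in\mathcal W$ (equivalently, $\sum_j\mathbf A_j\mathbf x_j^*=\mathbf c$ and $\mathbf A_j^T\mathbf z^*$ is a subgradient at $\mathbf x_j^*$ of $f_j$ restricted to $\mathcal X^j$ for each $j$). Augmented Lagrangian. For $\beta>0$, $$\mathcal L_\beta(\mathbf x_1,\dots,\mathbf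 x_l;\mathbf z)=\sum_{j=1}^l f_j(\mathbf x_j)-\Big\langle\mathbf z,\sum_{j=1}^l\mathbf A_j\mathbf x_j-\mathbf c\Big\rangle+\frac\beta2\Big\|\sum_{j=1}^l\mathbf A_j\mathbf x_j-\mathbf c\Big\|_2^2 .$$ Notation. For a symmetric matrix $\mathbf M$, $\|\mathbf u\|_{\mathbf M}^2=\mathbf u^T\mathbf M\mathbf u$; $\mathbf M\succeq\mathbf N$ (resp. $\mathbf M\succ\mathbf N$) means that $\mathbf M-\mathbf N$ is positive semidefinite (resp. positive definite). Prox-IADMM. Input: symmetric matrices $\mathbf H_j\succeq\mathbf O$ of size $n_j$, $1\le j\le l$, $\beta>0$, step sizes $\alpha_k$, $k\ge0$. Initial point $\mathbf w^0=(\mathbf x_1^0,\dots,\mathbf x_l^0;\mathbf z^0)\in\mathcal W$, with $\mathbf w^{-1}=\mathbf w^0$. For $k\ge 0$: set $\bar{\mathbf w}^k=(\bar{\mathbf x}_1^k,\dots,\bar{\mathbf x}_l^k;\bar{\mathbf z}^k)=\mathbf w^k+\alpha_k(\mathbf w^k-\mathbf w^{k-1})$, and let $$\mathbf x_1^{k+1}\in\arg\min_{\mathbf x_1\in\mathcal X^1}\mathcal L_\beta(\mathbf x_1,\bar{\mathbf x}_2^k,\dots,\bar{\mathbf x}_l^k;\bar{\mathbf z}^k)+\tfrac12\|\mathbf x_1-\bar{\mathbf x}_1^k\|_{\mathbf H_1}^2,$$ $$\mathbf z^{k+1}=\bar{\mathbf z}^k-\beta\Big(\mathbf A_1\mathbf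 x_1^{k+1}+\sum_{j=2}^l\mathbf A_j\bar{\mathbf x}_j^k-\mathbf c\Big),$$ $$\mathbf x_i^{k+1}\in\arg\min_{\mathbf x_i\in\mathcal X^i}\mathcal L_\beta(\mathbf x_1^{k+1},\bar{\mathbf x}_2^k,\dots,\bar{\mathbf x}_{i-1}^k,\mathbf x_i,\bar{\mathbf x}_{i+1}^k,\dots,\bar{\mathbf x}_l^k;\mathbf z^{k+1})+\tfrac12\|\mathbf x_i-\bar{\mathbf x}_i^k\|_{\mathbf H_i}^2,\quad 2\le i\le l.$$ Matrix $\mathbf G$. $\mathbf G$ is the symmetric matrix of size $n+m$, in block form relative to $(\mathbf x_1,\dots,\mathbf x_l;\mathbf z)$, whose diagonal blocks are $\mathbf H_1$, $\beta\mathbf A_j^T\mathbf A_j+\mathbf H_j$ ($2\le j\le l$), and $\frac1\beta\mathbf I_m$; whose $(\mathbf x_j,\mathbf z)$ block is $-\mathbf A_j^T$ and $(\mathbf z,\mathbf x_j)$ block is $-\mathbf A_j$ for $2\le j\le l$; and all of whose other blocks are zero. *)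

theory Defs
  imports "HOL-Analysis.Analysis" "Jordan_Normal_Form.Matrix"
begin

text \<open>
  The block sizes \<open>n j\<close> vary with \<open>j\<close>, so vectors and matrices are those of
  \<open>Jordan_Normal_Form\<close>: an element of \<open>R\<close>-to-the-\<open>n\<close> is a member of \<open>carrier_vec n\<close>.
  \<open>vec_topology n\<close> is the Euclidean topology on that carrier. The summation bound in
  \<open>vec_dist\<close> is explicit, so that symmetry holds for arbitrary arguments, as the locale
  \<open>Metric_space\<close> requires.
\<close>

unbundle no vec_syntax and no inner_syntax

definition vec_dist :: "nat \<Rightarrow> real vec \<Rightarrow> real vec \<Rightarrow> real" where
  "vec_dist n u v = L2_set (\<lambda>i. u $ i - v $ i) {..<n}"

lemma Metric_space_vec: "Metric_space (carrier_vec n) (vec_dist n)"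
proof
  fix x y z :: "real vec"
  show "0 \<le> vec_dist n x y"
    by (simp add: vec_dist_def L2_set_nonneg)
  show "vec_dist n x y = vec_dist n y x"
    by (simp add: vec_dist_def L2_set_def power2_commute)
  show "vec_dist n x y = 0 \<longleftrightarrow> x = y" if "x \<in> carrier_vec n" "y \<in> carrier_vec n"
    using that by (auto simp: vec_dist_def L2_set_eq_0_iff)
  show "vec_dist n x z \<le> vec_dist n x y + vec_dist n y z"
    using L2_set_triangle_ineq[of "\<lambda>i. x $ i - y $ i" "\<lambda>i. y $ i - z $ i" "{..<n}"]
    by (simp add: vec_dist_def)
qed

definition vec_topology :: "nat \<Rightarrow> real vec topology" where
  "vec_topology n = Metric_space.mtopology (carrier_vec n) (vec_dist n)"

lemma topspace_vec_topology [simp]: "topspace (vec_topology n) = carrier_vec n"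
  by (simp add: vec_topology_def Metric_space.topspace_mtopology[OF Metric_space_vec])

definition convex_vec_set :: "nat \<Rightarrow> real vec set \<Rightarrow> bool" where
  "convex_vec_set n X \<longleftrightarrow> X \<subseteq> carrier_vec n \<and>
     (\<forall>x\<in>X. \<forall>y\<in>X. \<forall>t\<in>{0..1}. (1 - t) \<cdot>\<^sub>v x + t \<cdot>\<^sub>v y \<in> X)"

definition convex_vec_fun :: "nat \<Rightarrow> (real vec \<Rightarrow> real) \<Rightarrow> bool" where
  "convex_vec_fun n f \<longleftrightarrow> (\<forall>x\<in>carrier_vec n. \<forall>y\<in>carrier_vec n. \<forall>t\<in>{0..1}.
     f ((1 - t) \<cdot>\<^sub>v x + t \<cdot>\<^sub>v y) \<le> (1 - t) * f x + t * f y)"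

text \<open>A function is closed if its epigraph is.\<close>

definition closed_vec_fun :: "nat \<Rightarrow> (real vec \<Rightarrow> real) \<Rightarrow> bool" where
  "closed_vec_fun n f \<longleftrightarrow> closedin (prod_topology (vec_topology n) euclideanreal)
     {(x, r). x \<in> carrier_vec n \<and> f x \<le> r}"

definition quad_norm :: "real mat \<Rightarrow> real vec \<Rightarrow> real" where
  "quad_norm M u = u \<bullet> (M *\<^sub>v u)"

definition pos_semidef :: "nat \<Rightarrow> real mat \<Rightarrow> bool" where
  "pos_semidef n M \<longleftrightarrow> M \<in> carrier_mat n n \<and> transpose_mat M = M \<and>
     (\<forall>u\<in>carrier_vec n. 0 \<le> u \<bullet> (M *\<^sub>v u))"

definition pos_def :: "nat \<Rightarrow> real mat \<Rightarrow> bool" where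
  "pos_def n M \<longleftrightarrow> M \<in> carrier_mat n n \<and> transpose_mat M = M \<and>
     (\<forall>u\<in>carrier_vec n. u \<noteq> 0\<^sub>v n \<longrightarrow> 0 < u \<bullet> (M *\<^sub>v u))"

text \<open>
  Vectors and matrices in block form, with blocks numbered \<open>1, \<dots>, L\<close> and of sizes \<open>d j\<close>.
  Position \<open>p\<close> of the large vector is entry \<open>a\<close> of block \<open>j\<close>, where \<open>(j, a)\<close> is the
  \<open>p\<close>-th entry of \<open>block_index d L\<close>.
\<close>

definition block_index :: "(nat \<Rightarrow> nat) \<Rightarrow> nat \<Rightarrow> (nat \<times> nat) list" where
  "block_index d L = concat (map (\<lambda>j. map (Pair j) [0..<d j]) [1..<Suc L])"

definition block_vec :: "(nat \<Rightarrow> nat) \<Rightarrow> nat \<Rightarrow> (nat \<Rightarrow> real vec) \<Rightarrow> real vec" where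
  "block_vec d L v = vec (length (block_index d L))
     (\<lambda>p. case block_index d L ! p of (j, a) \<Rightarrow> v j $ a)"

definition block_mat :: "(nat \<Rightarrow> nat) \<Rightarrow> nat \<Rightarrow> (nat \<Rightarrow> nat \<Rightarrow> real mat) \<Rightarrow> real mat" where
  "block_mat d L M = mat (length (block_index d L)) (length (block_index d L))
     (\<lambda>(p, q). case (block_index d L ! p, block_index d L ! q) of
        ((i, a), (j, b)) \<Rightarrow> M i j $$ (a, b))"

lemma length_block_index: "length (block_index d L) = (\<Sum>j=1..L. d j)"
proof -
  have "length (block_index d L) = (\<Sum>j\<leftarrow>[1..<Suc L]. d j)"
    by (simp only: block_index_def length_concat map_map comp_def length_map length_upt diff_zero)
  also have "\<dots> = (\<Sum>j\<in>{1..<Suc L}. d j)"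
    by (simp only: interv_sum_list_conv_sum_set_nat set_upt)
  also have "{1..<Suc L} = {1..L}"
    by (rule atLeastLessThanSuc_atLeastAtMost)
  finally show ?thesis .
qed

text \<open>
  The point \<open>(x 1, \<dots>, x l; z)\<close>: blocks \<open>1, \<dots>, l\<close> are the \<open>x j\<close>, block \<open>l + 1\<close> is \<open>z\<close>.
  Values \<open>x j\<close> with \<open>j\<close> outside \<open>{1..l}\<close> are irrelevant.
\<close>

definition dims :: "nat \<Rightarrow> nat \<Rightarrow> (nat \<Rightarrow> nat) \<Rightarrow> nat \<Rightarrow> nat" where
  "dims l m n j = (if j \<le> l then n j else m)"

definition point :: "nat \<Rightarrow> nat \<Rightarrow> (nat \<Rightarrow> nat) \<Rightarrow> (nat \<Rightarrow> real vec) \<Rightarrow> real vec \<Rightarrow> real vec" where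
  "point l m n x z = block_vec (dims l m n) (Suc l) (\<lambda>j. if j \<le> l then x j else z)"

lemma point_carrier: "point l m n x z \<in> carrier_vec ((\<Sum>j=1..l. n j) + m)"
proof -
  have "(\<Sum>j=1..Suc l. dims l m n j) = (\<Sum>j=1..l. dims l m n j) + dims l m n (Suc l)"
    by (rule sum.cl_ivl_Suc[THEN trans]) simp
  also have "(\<Sum>j=1..l. dims l m n j) = (\<Sum>j=1..l. n j)"
    by (rule sum.cong) (simp_all add: dims_def)
  also have "dims l m n (Suc l) = m"
    by (simp add: dims_def)
  finally show ?thesis
    unfolding point_def block_vec_def length_block_index by (metis vec_carrier)
qed

definition residual ::
  "nat \<Rightarrow> nat \<Rightarrow> (nat \<Rightarrow> real mat) \<Rightarrow> real vec \<Rightarrow> (nat \<Rightarrow> real vec) \<Rightarrow> real vec" where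
  "residual l m A c x = finsum_vec TYPE(real) m (\<lambda>j. A j *\<^sub>v x j) {1..l} - c"

definition VI_map :: "nat \<Rightarrow> nat \<Rightarrow> (nat \<Rightarrow> nat) \<Rightarrow> (nat \<Rightarrow> real mat) \<Rightarrow> real vec
    \<Rightarrow> (nat \<Rightarrow> real vec) \<Rightarrow> real vec \<Rightarrow> real vec" where
  "VI_map l m n A c x z =
     point l m n (\<lambda>j. - (transpose_mat (A j) *\<^sub>v z)) (residual l m A c x)"

definition feasible_blocks ::
  "nat \<Rightarrow> nat \<Rightarrow> (nat \<Rightarrow> real vec set) \<Rightarrow> (nat \<Rightarrow> real vec) \<Rightarrow> real vec \<Rightarrow> bool" where
  "feasible_blocks l m X x z \<longleftrightarrow> (\<forall>j\<in>{1..l}. x j \<in> X j) \<and> z \<in> carrier_vec m"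

definition kkt_points :: "nat \<Rightarrow> nat \<Rightarrow> (nat \<Rightarrow> nat) \<Rightarrow> (nat \<Rightarrow> real mat) \<Rightarrow> real vec
    \<Rightarrow> (nat \<Rightarrow> real vec set) \<Rightarrow> (nat \<Rightarrow> real vec \<Rightarrow> real) \<Rightarrow> real vec set" where
  "kkt_points l m n A c X f = {point l m n xs zs | xs zs. feasible_blocks l m X xs zs \<and>
     (\<forall>x z. feasible_blocks l m X x z \<longrightarrow>
        (\<Sum>j=1..l. f j (x j)) - (\<Sum>j=1..l. f j (xs j))
          + (point l m n x z - point l m n xs zs) \<bullet> VI_map l m n A c xs zs \<ge> 0)}"

definition aug_lagrangian :: "nat \<Rightarrow> nat \<Rightarrow> (nat \<Rightarrow> real mat) \<Rightarrow> real vec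
    \<Rightarrow> (nat \<Rightarrow> real vec \<Rightarrow> real) \<Rightarrow> real \<Rightarrow> (nat \<Rightarrow> real vec) \<Rightarrow> real vec \<Rightarrow> real" where
  "aug_lagrangian l m A c f \<beta> x z =
     (\<Sum>j=1..l. f j (x j)) - z \<bullet> residual l m A c x
       + \<beta> / 2 * (residual l m A c x \<bullet> residual l m A c x)"

definition G_block :: "nat \<Rightarrow> nat \<Rightarrow> (nat \<Rightarrow> nat) \<Rightarrow> (nat \<Rightarrow> real mat) \<Rightarrow> (nat \<Rightarrow> real mat)
    \<Rightarrow> real \<Rightarrow> nat \<Rightarrow> nat \<Rightarrow> real mat" where
  "G_block l m n A H \<beta> i j =
     (if i = 1 \<and> j = 1 then H 1
      else if i = j \<and> i \<in> {2..l} then \<beta> \<cdot>\<^sub>m (transpose_mat (A j) * A j) + H j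
      else if i = Suc l \<and> j = Suc l then (1 / \<beta>) \<cdot>\<^sub>m 1\<^sub>m m
      else if i \<in> {2..l} \<and> j = Suc l then - transpose_mat (A i)
      else if i = Suc l \<and> j \<in> {2..l} then - A j
      else 0\<^sub>m (dims l m n i) (dims l m n j))"

definition G_mat :: "nat \<Rightarrow> nat \<Rightarrow> (nat \<Rightarrow> nat) \<Rightarrow> (nat \<Rightarrow> real mat) \<Rightarrow> (nat \<Rightarrow> real mat)
    \<Rightarrow> real \<Rightarrow> real mat" where
  "G_mat l m n A H \<beta> = block_mat (dims l m n) (Suc l) (G_block l m n A H \<beta>)"

text \<open>
  Extrapolation. The truncated subtraction \<open>0 - 1 = 0\<close> on naturals realises the convention
  that the iterate with index \<open>-1\<close> is the initial point.
\<close>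

definition extrapolate :: "(nat \<Rightarrow> real) \<Rightarrow> (nat \<Rightarrow> real vec) \<Rightarrow> nat \<Rightarrow> real vec" where
  "extrapolate \<alpha> u k = u k + \<alpha> k \<cdot>\<^sub>v (u k - u (k - 1))"

text \<open>
  \<open>x k j\<close> is the \<open>j\<close>-th primal block of the \<open>k\<close>-th iterate and \<open>z k\<close> its multiplier block.
  The updates of the blocks \<open>2, \<dots>, l\<close> use the new first block and the extrapolated values of
  all other blocks.
\<close>

definition prox_iadmm :: "nat \<Rightarrow> nat \<Rightarrow> (nat \<Rightarrow> real mat) \<Rightarrow> real vec \<Rightarrow> (nat \<Rightarrow> real vec set)
    \<Rightarrow> (nat \<Rightarrow> real vec \<Rightarrow> real) \<Rightarrow> (nat \<Rightarrow> real mat) \<Rightarrow> real \<Rightarrow> (nat \<Rightarrow> real)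
    \<Rightarrow> (nat \<Rightarrow> nat \<Rightarrow> real vec) \<Rightarrow> (nat \<Rightarrow> real vec) \<Rightarrow> bool" where
  "prox_iadmm l m A c X f H \<beta> \<alpha> x z \<longleftrightarrow>
     feasible_blocks l m X (x 0) (z 0) \<and>
     (\<forall>k. let xb = (\<lambda>j. extrapolate \<alpha> (\<lambda>k. x k j) k);
              zb = extrapolate \<alpha> z k
          in
            is_arg_min (\<lambda>u. aug_lagrangian l m A c f \<beta> (xb(1 := u)) zb
                              + 1 / 2 * quad_norm (H 1) (u - xb 1))
              (\<lambda>u. u \<in> X 1) (x (Suc k) 1)
          \<and> z (Suc k) = zb - \<beta> \<cdot>\<^sub>v residual l m A c (xb(1 := x (Suc k) 1))
          \<and> (\<forall>i\<in>{2..l}.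
               is_arg_min (\<lambda>u. aug_lagrangian l m A c f \<beta> (xb(1 := x (Suc k) 1, i := u)) (z (Suc k))
                                 + 1 / 2 * quad_norm (H i) (u - xb i))
                 (\<lambda>u. u \<in> X i) (x (Suc k) i)))"

end

theory Submission
  imports Defs
begin

text \<open>
  The method is an inertial proximal point method for a monotone variational inequality, in the
  metric of the block matrix \<open>G\<close>. Let \<open>\<theta>\<close> be the objective, \<open>r\<close> the residual of the linear
  constraint and \<open>\<langle>u, v\<rangle>\<close> the inner product. A KKT point is a saddle point \<open>(xs; zs)\<close> of the
  Lagrangian: \<open>\<theta>(v) - \<theta>(xs) + \<langle>r(xs), \<zeta>\<rangle> - \<langle>r(v), zs\<rangle> \<ge> 0\<close> for all feasible \<open>(v; \<zeta>)\<close>. This is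
  the definition rewritten with the skewness of the map \<open>F\<close> (\<open>VI_map_gap\<close>).

  The optimality conditions of the \<open>l\<close> block subproblems and the multiplier update add up to the
  same inequality for the new iterate \<open>(x; z) = w (k + 1)\<close>, with one extra term
  \<open>\<langle>(v; \<zeta>) - w (k + 1), G (w (k + 1) - wb k)\<rangle>\<close>, where \<open>wb k\<close> is the extrapolated point
  (\<open>proximal_variational_inequality\<close>). Take for \<open>(v; \<zeta>)\<close> a KKT point \<open>s\<close> and add the
  inequality of that KKT point at the iterate: all terms but the extra one cancel, and
  \<open>\<langle>w (k + 1) - s, G (w (k + 1) - wb k)\<rangle> \<le> 0\<close> is left.

  The lower bounds on the \<open>H j\<close> make \<open>G\<close> positive definite (\<open>G_mat_pos_def\<close>). The last
  inequality then bounds the growth of the squared \<open>G\<close>-distance to \<open>s\<close> by a fraction \<open>\<alpha> k\<close> of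
  its preceding growth plus a summable error. So this distance converges for every KKT point
  \<open>s\<close> (\<open>inertial_recursion_convergent\<close>) and \<open>w (k + 1) - wb k\<close> tends to zero. The iterates are
  bounded, and the limit of the proximal inequality, for which closed epigraphs suffice, shows
  that their cluster points are KKT points. The distance to a cluster point converges and has
  the limit zero along a subsequence, so the whole sequence converges
  (\<open>inertial_fejer_convergence\<close>).

  The limit point is feasible and optimal, which gives the convergence of the residuals. The
  objective values lie between two bounds: the KKT inequality at the iterate from below, and the
  proximal inequality at the limit point from above. Both bounds tend to the optimal value.
\<close>

section \<open>Vectors: limits, compactness and positive definite forms\<close>

text \<open>
  Reduces limits in the metric topology to limits of real sequences, the form in which all
  limits of vectors are computed below.
\<close>

lemma limitin_vec_iff:
  assumes u: "\<And>k. u k \<in> carrier_vec n" and v: "v \<in> carrier_vec n"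
  shows "limitin (vec_topology n) u v sequentially \<longleftrightarrow> (\<forall>i<n. (\<lambda>k. u k $ i) \<longlonglongrightarrow> v $ i)"
proof -
  have "limitin (vec_topology n) u v sequentially \<longleftrightarrow> (\<lambda>k. vec_dist n (u k) v) \<longlonglongrightarrow> 0"
    unfolding vec_topology_def Metric_space.limitin_metric_dist_null[OF Metric_space_vec]
    using u v by simp
  also have "\<dots> \<longleftrightarrow> (\<forall>i<n. (\<lambda>k. u k $ i) \<longlonglongrightarrow> v $ i)"
  proof (intro iffI allI impI)
    fix i assume lim: "(\<lambda>k. vec_dist n (u k) v) \<longlonglongrightarrow> 0" and i: "i < n"
    have "norm (u k $ i - v $ i) \<le> vec_dist n (u k) v" for k
      using member_le_L2_set[of "{..<n}" i "\<lambda>i. \<bar>u k $ i - v $ i\<bar>"] i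
      by (simp add: vec_dist_def L2_set_def)
    then have "(\<lambda>k. u k $ i - v $ i) \<longlonglongrightarrow> 0"
      by (intro Lim_null_comparison[OF _ lim]) simp
    then show "(\<lambda>k. u k $ i) \<longlonglongrightarrow> v $ i"
      by (simp add: LIM_zero_iff)
  next
    assume lim: "\<forall>i<n. (\<lambda>k. u k $ i) \<longlonglongrightarrow> v $ i"
    have "(\<lambda>k. sqrt (\<Sum>i<n. (u k $ i - v $ i)\<^sup>2)) \<longlonglongrightarrow> sqrt (\<Sum>i<n. (v $ i - v $ i)\<^sup>2)"
      using lim by (intro tendsto_intros) auto
    then show "(\<lambda>k. vec_dist n (u k) v) \<longlonglongrightarrow> 0"
      by (simp add: vec_dist_def L2_set_def)
  qed
  finally show ?thesis .
qed

lemma limitin_vec_carrier: "limitin (vec_topology n) u v F \<Longrightarrow> v \<in> carrier_vec n"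
  using limitin_topspace[of "vec_topology n" u v F] by simp

lemma limitin_vec_index:
  assumes "limitin (vec_topology n) u v sequentially" "\<And>k. u k \<in> carrier_vec n" "i < n"
  shows "(\<lambda>k. u k $ i) \<longlonglongrightarrow> v $ i"
  using assms limitin_vec_iff[OF assms(2) limitin_vec_carrier[OF assms(1)]] by simp

lemma tendsto_scalar_prod_vec:
  assumes "\<And>k. u k \<in> carrier_vec n" "\<And>k. v k \<in> carrier_vec n"
    and "limitin (vec_topology n) u a sequentially" "limitin (vec_topology n) v b sequentially"
  shows "(\<lambda>k. u k \<bullet> v k) \<longlonglongrightarrow> a \<bullet> b"
proof -
  have ab: "a \<in> carrier_vec n" "b \<in> carrier_vec n"
    using assms(3,4) by (auto intro: limitin_vec_carrier)
  have "(\<lambda>k. \<Sum>i<n. u k $ i * v k $ i) \<longlonglongrightarrow> (\<Sum>i<n. a $ i * b $ i)"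
    using assms ab by (intro tendsto_intros) (auto simp: limitin_vec_iff)
  moreover have "u k \<bullet> v k = (\<Sum>i<n. u k $ i * v k $ i)" for k
    using assms(2)[of k] by (simp add: scalar_prod_def lessThan_atLeast0)
  moreover have "a \<bullet> b = (\<Sum>i<n. a $ i * b $ i)"
    using ab by (simp add: scalar_prod_def lessThan_atLeast0)
  ultimately show ?thesis by simp
qed

lemma limitin_vec_const:
  "v \<in> carrier_vec n \<Longrightarrow> limitin (vec_topology n) (\<lambda>k. v) v sequentially"
  by simp

lemma limitin_vec_minus:
  assumes "\<And>k. u k \<in> carrier_vec n" "\<And>k. v k \<in> carrier_vec n"
    and "limitin (vec_topology n) u a sequentially" "limitin (vec_topology n) v b sequentially"
  shows "limitin (vec_topology n) (\<lambda>k. u k - v k) (a - b) sequentially"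
proof -
  have ab: "a \<in> carrier_vec n" "b \<in> carrier_vec n"
    using assms(3,4) by (auto intro: limitin_vec_carrier)
  have idx: "(u k - v k) $ i = u k $ i - v k $ i" if "i < n" for k i
    using assms(2)[of k] that by auto
  show ?thesis
    using assms ab by (subst limitin_vec_iff) (auto simp: limitin_vec_iff idx intro!: tendsto_diff)
qed

lemma limitin_mult_mat_vec:
  assumes M: "M \<in> carrier_mat m n" and u: "\<And>k. u k \<in> carrier_vec n"
    and lim: "limitin (vec_topology n) u a sequentially"
  shows "limitin (vec_topology m) (\<lambda>k. M *\<^sub>v u k) (M *\<^sub>v a) sequentially"
proof -
  have a: "a \<in> carrier_vec n" using lim by (rule limitin_vec_carrier)
  have "(\<lambda>k. (M *\<^sub>v u k) $ i) \<longlonglongrightarrow> (M *\<^sub>v a) $ i" if "i < m" for i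
  proof -
    have "(\<lambda>k. row M i \<bullet> u k) \<longlonglongrightarrow> row M i \<bullet> a"
      using M that by (intro tendsto_scalar_prod_vec[OF _ u _ lim] limitin_vec_const) auto
    then show ?thesis using M that by simp
  qed
  then show ?thesis using M u a by (subst limitin_vec_iff) auto
qed

lemma scalar_prod_self_eq_0_iff:
  fixes u :: "real vec"
  assumes "u \<in> carrier_vec n"
  shows "u \<bullet> u = 0 \<longleftrightarrow> u = 0\<^sub>v n"
proof
  assume "u \<bullet> u = 0"
  then have "\<forall>i\<in>{0..<n}. u $ i * u $ i = 0"
    using assms by (subst sum_nonneg_eq_0_iff[symmetric]) (auto simp: scalar_prod_def)
  then show "u = 0\<^sub>v n" using assms by (intro eq_vecI) auto
qed (use assms in simp)

lemma scalar_prod_self_nonneg: "0 \<le> (u :: real vec) \<bullet> u"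
  by (auto simp: scalar_prod_def intro!: sum_nonneg)

lemma index_le_scalar_prod_self:
  fixes u :: "real vec"
  assumes "u \<in> carrier_vec n" "i < n"
  shows "(u $ i)\<^sup>2 \<le> u \<bullet> u"
proof -
  have "u $ i * u $ i \<le> (\<Sum>i\<in>{0..<n}. u $ i * u $ i)"
    using assms by (intro member_le_sum) auto
  then show ?thesis using assms by (simp add: scalar_prod_def power2_eq_square)
qed

text \<open>The Bolzano--Weierstrass theorem.\<close>

lemma bounded_vec_seq_subseq:
  fixes u :: "nat \<Rightarrow> real vec"
  assumes u: "\<And>k. u k \<in> carrier_vec n" and B: "\<And>k. u k \<bullet> u k \<le> B"
  obtains r v where "strict_mono r" "limitin (vec_topology n) (u \<circ> r) v sequentially"
proof -
  have bd: "bounded ((\<lambda>x. x i) ` range (\<lambda>k i. u k $ i))" if "i \<in> {..<n}" for i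
  proof -
    have "\<bar>u k $ i\<bar> \<le> sqrt B" for k
      using index_le_scalar_prod_self[OF u, of i k] B[of k] that
      by (intro real_le_rsqrt) auto
    then show ?thesis by (intro boundedI[where B = "sqrt B"]) auto
  qed
  obtain l r where r: "strict_mono r"
    and lim: "\<forall>e>0. \<forall>\<^sub>F k in sequentially. \<forall>i\<in>{..<n}. dist (u (r k) $ i) (l i) < e"
    using compact_lemma_general[of "{..<n}" "\<lambda>x i. x i" "\<lambda>k i. u k $ i" "\<lambda>x. x"] bd by auto
  have "(\<lambda>k. u (r k) $ i) \<longlonglongrightarrow> vec n l $ i" if "i < n" for i
    unfolding tendsto_iff
  proof (intro allI impI)
    fix e :: real assume "e > 0"
    with lim have "\<forall>\<^sub>F k in sequentially. \<forall>i\<in>{..<n}. dist (u (r k) $ i) (l i) < e" by blast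
    then show "\<forall>\<^sub>F k in sequentially. dist (u (r k) $ i) (vec n l $ i) < e"
      by eventually_elim (use that in auto)
  qed
  then have "limitin (vec_topology n) (u \<circ> r) (vec n l) sequentially"
    using u by (subst limitin_vec_iff) auto
  with r show thesis by (rule that)
qed

lemma quad_norm_smult:
  assumes "M \<in> carrier_mat n n" "u \<in> carrier_vec n"
  shows "quad_norm M (t \<cdot>\<^sub>v u) = t\<^sup>2 * quad_norm M u"
  unfolding quad_norm_def using assms
  by (simp add: mult_mat_vec power2_eq_square)

text \<open>
  The unit sphere is compact: if no constant worked, normalised
  vectors with form values below \<open>1 / (k + 1)\<close> would accumulate at a unit vector on which the
  form is not positive.
\<close>

lemma pos_def_lower_bound:
  assumes M: "pos_def n M"
  obtains \<kappa> where "\<kappa> > 0" "\<And>u. u \<in> carrier_vec n \<Longrightarrow> \<kappa> * (u \<bullet> u) \<le> quad_norm M u"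
proof -
  have Mc: "M \<in> carrier_mat n n" using M by (simp add: pos_def_def)
  have "\<exists>\<kappa>>0. \<forall>u\<in>carrier_vec n. \<kappa> * (u \<bullet> u) \<le> quad_norm M u"
  proof (rule ccontr)
    assume "\<not> ?thesis"
    then have "\<forall>k. \<exists>u\<in>carrier_vec n. quad_norm M u < 1 / real (Suc k) * (u \<bullet> u)"
      by (metis not_le of_nat_0_less_iff zero_less_Suc zero_less_divide_1_iff)
    then obtain u where u: "\<And>k. u k \<in> carrier_vec n"
      and less: "\<And>k. quad_norm M (u k) < 1 / real (Suc k) * (u k \<bullet> u k)"
      by metis
    have pos: "u k \<bullet> u k > 0" for k
    proof (rule ccontr)
      assume "\<not> ?thesis"
      then have "u k \<bullet> u k = 0" using scalar_prod_self_nonneg[of "u k"] by simp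
      then have "u k = 0\<^sub>v n" using scalar_prod_self_eq_0_iff u by blast
      then have "quad_norm M (u k) = 0" "u k \<bullet> u k = 0" using Mc by (simp_all add: quad_norm_def)
      with less[of k] show False by simp
    qed
    define y where "y k = (1 / sqrt (u k \<bullet> u k)) \<cdot>\<^sub>v u k" for k
    have y: "y k \<in> carrier_vec n" for k using u by (simp add: y_def)
    have yy: "y k \<bullet> y k = 1" for k
      using u[of k] pos[of k] by (simp add: y_def)
    have yM: "quad_norm M (y k) \<le> 1 / real (Suc k)" for k
    proof -
      have "quad_norm M (y k) = quad_norm M (u k) / (u k \<bullet> u k)"
        using pos[of k] by (simp add: y_def quad_norm_smult[OF Mc u] power_divide)
      also have "\<dots> < 1 / real (Suc k)"
        using less[of k] pos[of k] by (simp only: pos_divide_less_eq)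
      finally show ?thesis by simp
    qed
    obtain r v where r: "strict_mono r" and lim: "limitin (vec_topology n) (y \<circ> r) v sequentially"
      using bounded_vec_seq_subseq[of y n 1] y yy by auto
    have yr: "\<And>k. (y \<circ> r) k \<in> carrier_vec n" using y by simp
    have v: "v \<in> carrier_vec n" using lim by (rule limitin_vec_carrier)
    have "(\<lambda>k. (y \<circ> r) k \<bullet> (y \<circ> r) k) \<longlonglongrightarrow> v \<bullet> v"
      by (rule tendsto_scalar_prod_vec[OF yr yr lim lim])
    then have "v \<bullet> v = 1" using yy by (simp add: LIMSEQ_const_iff)
    then have "v \<noteq> 0\<^sub>v n" by auto
    moreover have "(\<lambda>k. quad_norm M ((y \<circ> r) k)) \<longlonglongrightarrow> quad_norm M v"
      unfolding quad_norm_def using Mc yr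
      by (intro tendsto_scalar_prod_vec[OF yr _ lim] limitin_mult_mat_vec[OF Mc yr lim]) auto
    then have "quad_norm M v \<le> 0"
    proof (rule LIMSEQ_le)
      show "(\<lambda>k. 1 / real (Suc (r k))) \<longlonglongrightarrow> 0"
        using LIMSEQ_subseq_LIMSEQ[OF lim_1_over_n[THEN LIMSEQ_Suc] r] by (simp add: o_def)
    qed (use yM in auto)
    ultimately show False using M v by (force simp: pos_def_def quad_norm_def)
  qed
  with that show thesis by blast
qed

section \<open>Inertial sequences that are Fejer monotone\<close>

text \<open>
  Only the increases \<open>t k\<close> of \<open>\<phi>\<close> need control. They satisfy \<open>t (k + 1) \<le> a * t k + d k\<close> with
  \<open>a < 1\<close>, so they are summable, and subtracting their partial sums turns \<open>\<phi>\<close> into a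
  decreasing sequence that is bounded below.
\<close>

lemma inertial_recursion_convergent:
  fixes \<phi> :: "nat \<Rightarrow> real"
  assumes \<phi>: "\<And>k. 0 \<le> \<phi> k" and \<alpha>: "\<And>k. 0 \<le> \<alpha> k" "\<And>k. \<alpha> k \<le> a" and a: "a < 1"
    and d: "\<And>k. 0 \<le> d k" "summable d"
    and rec: "\<And>k. \<phi> (Suc (Suc k)) - \<phi> (Suc k) \<le> \<alpha> k * (\<phi> (Suc k) - \<phi> k) + d k"
  shows "convergent \<phi>"
proof -
  have a0: "0 \<le> a" using \<alpha>[of 0] by linarith
  define t where "t k = max 0 (\<phi> (Suc k) - \<phi> k)" for k
  have t0: "0 \<le> t k" for k by (simp add: t_def)
  have t_rec: "t (Suc k) \<le> a * t k + d k" for k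
  proof -
    have "\<alpha> k * (\<phi> (Suc k) - \<phi> k) \<le> \<alpha> k * t k"
      using \<alpha>(1) by (intro mult_left_mono) (auto simp: t_def)
    also have "\<dots> \<le> a * t k" using \<alpha>(2) t0 by (intro mult_right_mono)
    finally have "\<phi> (Suc (Suc k)) - \<phi> (Suc k) \<le> a * t k + d k" using rec[of k] by linarith
    moreover have "0 \<le> a * t k + d k" using a0 t0 d(1) by simp
    ultimately show ?thesis unfolding t_def[of "Suc k"] by simp
  qed
  have bound: "(\<Sum>k<N. t k) \<le> (t 0 + suminf d) / (1 - a)" for N
  proof -
    have "(\<Sum>k<N. t k) \<le> (\<Sum>k<Suc N. t k)" using t0 by simp
    also have "\<dots> = t 0 + (\<Sum>k<N. t (Suc k))" by (simp only: sum.lessThan_Suc_shift)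
    also have "(\<Sum>k<N. t (Suc k)) \<le> (\<Sum>k<N. a * t k + d k)" using t_rec by (intro sum_mono)
    also have "\<dots> = a * (\<Sum>k<N. t k) + (\<Sum>k<N. d k)" by (simp add: sum.distrib sum_distrib_left)
    also have "(\<Sum>k<N. d k) \<le> suminf d" using d by (intro sum_le_suminf) auto
    finally have "(1 - a) * (\<Sum>k<N. t k) \<le> t 0 + suminf d" by (simp add: algebra_simps)
    then show ?thesis using a by (simp add: pos_le_divide_eq mult.commute)
  qed
  have "convergent (\<lambda>N. \<Sum>k<N. t k)"
    using summableI_nonneg_bounded[OF t0 bound] by (simp add: summable_iff_convergent)
  moreover have "convergent (\<lambda>N. \<phi> N - (\<Sum>k<N. t k))"
  proof -
    have dec: "decseq (\<lambda>N. \<phi> N - (\<Sum>k<N. t k))"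
    proof (rule decseq_SucI)
      fix N
      have "\<phi> (Suc N) - \<phi> N \<le> t N" by (simp add: t_def)
      then show "\<phi> (Suc N) - (\<Sum>k<Suc N. t k) \<le> \<phi> N - (\<Sum>k<N. t k)" by simp
    qed
    have "- ((t 0 + suminf d) / (1 - a)) \<le> \<phi> N - (\<Sum>k<N. t k)" for N
      using bound[of N] \<phi>[of N] by linarith
    from decseq_convergent[OF dec allI[OF this]] show ?thesis
      by (auto simp: convergent_def)
  qed
  ultimately have "convergent (\<lambda>N. (\<Sum>k<N. t k) + (\<phi> N - (\<Sum>k<N. t k)))" by (rule convergent_add)
  then show ?thesis by simp
qed

lemma quad_norm_lincomb:
  assumes M: "M \<in> carrier_mat n n" "transpose_mat M = M"
    and uv: "u \<in> carrier_vec n" "v \<in> carrier_vec n"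
  shows "quad_norm M (s \<cdot>\<^sub>v u + t \<cdot>\<^sub>v v)
    = s\<^sup>2 * quad_norm M u + 2 * s * t * (u \<bullet> (M *\<^sub>v v)) + t\<^sup>2 * quad_norm M v"
proof -
  have "v \<bullet> (M *\<^sub>v u) = (M *\<^sub>v v) \<bullet> u"
    using transpose_vec_mult_scalar[OF M(1) uv] M(2) by simp
  also have "\<dots> = u \<bullet> (M *\<^sub>v v)" using uv M by (intro comm_scalar_prod[of _ n]) auto
  finally have sym: "v \<bullet> (M *\<^sub>v u) = u \<bullet> (M *\<^sub>v v)" .
  have Mc: "M *\<^sub>v u \<in> carrier_vec n" "M *\<^sub>v v \<in> carrier_vec n" using M uv by auto
  have "M *\<^sub>v (s \<cdot>\<^sub>v u + t \<cdot>\<^sub>v v) = s \<cdot>\<^sub>v (M *\<^sub>v u) + t \<cdot>\<^sub>v (M *\<^sub>v v)"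
    using M uv by (simp add: mult_add_distrib_mat_vec mult_mat_vec)
  then show ?thesis
    using uv Mc unfolding quad_norm_def
    by (simp add: add_scalar_prod_distrib[where n = n] scalar_prod_add_distrib[where n = n] sym
        algebra_simps power2_eq_square)
qed

lemma extrapolate_carrier: "(\<And>k. u k \<in> carrier_vec n) \<Longrightarrow> extrapolate \<alpha> u k \<in> carrier_vec n"
  by (simp add: extrapolate_def)

text \<open>
  Convergence of an abstract inertial proximal point method. In the metric of \<open>M\<close>, the Fejer
  inequality makes the squared distances \<open>\<phi> k\<close> to any point of \<open>S\<close> satisfy the recursion of
  \<open>inertial_recursion_convergent\<close>, because the squared distance of the extrapolated point is
  \<open>(1 + t) \<phi> k - t \<phi> (k - 1) + t (1 + t) \<delta>\<close> with \<open>t = \<alpha> k\<close> and \<open>\<delta>\<close> the squared length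
  of the last step.
  So these distances converge and the proximal increments \<open>e k\<close> vanish. By compactness there
  is a cluster point; it lies in \<open>S\<close>, so the distance to it converges, and the limit is zero
  along a subsequence and hence along the whole sequence.
\<close>

theorem inertial_fejer_convergence:
  fixes w :: "nat \<Rightarrow> real vec"
  assumes M: "pos_def n M"
    and w: "\<And>k. w k \<in> carrier_vec n"
    and \<alpha>: "\<And>k. 0 \<le> \<alpha> k" "\<And>k. \<alpha> k \<le> a" and a: "a < 1"
    and S: "S \<subseteq> carrier_vec n" "S \<noteq> {}"
    and fejer: "\<And>s k. s \<in> S \<Longrightarrow>
      (w (Suc k) - s) \<bullet> (M *\<^sub>v (w (Suc k) - extrapolate \<alpha> w k)) \<le> 0"
    and sum: "summable (\<lambda>k. \<alpha> (Suc k) * quad_norm M (w (Suc k) - w k))"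
    and cluster: "\<And>r v. strict_mono r \<Longrightarrow>
      limitin (vec_topology n) (\<lambda>i. w (Suc (r i))) v sequentially \<Longrightarrow>
      limitin (vec_topology n) (\<lambda>i. w (Suc (r i)) - extrapolate \<alpha> w (r i)) (0\<^sub>v n) sequentially \<Longrightarrow>
      v \<in> S"
  obtains s where "s \<in> S" "limitin (vec_topology n) w s sequentially"
    "limitin (vec_topology n) (\<lambda>k. w (Suc k) - extrapolate \<alpha> w k) (0\<^sub>v n) sequentially"
proof -
  have Mc: "M \<in> carrier_mat n n" and Mt: "transpose_mat M = M"
    using M by (auto simp: pos_def_def)
  obtain \<kappa> where \<kappa>: "\<kappa> > 0" "\<And>u. u \<in> carrier_vec n \<Longrightarrow> \<kappa> * (u \<bullet> u) \<le> quad_norm M u"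
    using pos_def_lower_bound[OF M] by metis
  have Q0: "0 \<le> quad_norm M u" if "u \<in> carrier_vec n" for u
    using \<kappa>(2)[OF that] \<kappa>(1) scalar_prod_self_nonneg[of u]
    by (meson mult_nonneg_nonneg less_imp_le order_trans)
  have null: "limitin (vec_topology n) u (0\<^sub>v n) sequentially"
    if u: "\<And>k. u k \<in> carrier_vec n" and lim: "(\<lambda>k. quad_norm M (u k)) \<longlonglongrightarrow> 0" for u
  proof -
    have "(\<lambda>k. u k $ i) \<longlonglongrightarrow> 0" if "i < n" for i
    proof -
      have "norm ((u k $ i)\<^sup>2) \<le> quad_norm M (u k) / \<kappa>" for k
      proof -
        have "(u k $ i)\<^sup>2 \<le> u k \<bullet> u k" using u that by (rule index_le_scalar_prod_self)
        also have "\<dots> \<le> quad_norm M (u k) / \<kappa>"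
          using \<kappa>(2)[OF u[of k]] \<kappa>(1) by (simp add: pos_le_divide_eq mult.commute)
        finally show ?thesis by simp
      qed
      moreover have "(\<lambda>k. quad_norm M (u k) / \<kappa>) \<longlonglongrightarrow> 0" using tendsto_divide_zero[OF lim] .
      ultimately have "(\<lambda>k. (u k $ i)\<^sup>2) \<longlonglongrightarrow> 0"
        by (intro Lim_null_comparison[of "\<lambda>k. (u k $ i)\<^sup>2"]) auto
      then have "(\<lambda>k. sqrt ((u k $ i)\<^sup>2)) \<longlonglongrightarrow> sqrt 0" by (rule tendsto_real_sqrt)
      then show ?thesis by (simp add: tendsto_rabs_zero_iff)
    qed
    then show ?thesis using u by (subst limitin_vec_iff) auto
  qed
  define e where "e k = w (Suc k) - extrapolate \<alpha> w k" for k
  have wb: "extrapolate \<alpha> w k \<in> carrier_vec n" for k using w by (rule extrapolate_carrier)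
  have e: "e k \<in> carrier_vec n" for k using w wb by (simp add: e_def)
  define d where "d k = 2 * (\<alpha> (Suc k) * quad_norm M (w (Suc k) - w k))" for k
  have d: "0 \<le> d k" "summable d" for k
    unfolding d_def using \<alpha> Q0 w sum by (auto intro!: mult_nonneg_nonneg summable_mult)
  have step: "quad_norm M (w (Suc (Suc k)) - s) + quad_norm M (e (Suc k))
      \<le> quad_norm M (w (Suc k) - s)
        + \<alpha> (Suc k) * (quad_norm M (w (Suc k) - s) - quad_norm M (w k - s)) + d k"
    if "s \<in> S" for s k
  proof -
    have s: "s \<in> carrier_vec n" using S that by auto
    define p b b' where "p = w (Suc (Suc k)) - s" and "b = w (Suc k) - s" and "b' = w k - s"
    have pc: "p \<in> carrier_vec n" "b \<in> carrier_vec n" "b' \<in> carrier_vec n"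
      using w s by (auto simp: p_def b_def b'_def)
    have ek: "e (Suc k) \<in> carrier_vec n" by (rule e)
    define t where "t = \<alpha> (Suc k)"
    have t: "0 \<le> t" "t \<le> 1" using \<alpha>(1)[of "Suc k"] \<alpha>(2)[of "Suc k"] a by (auto simp: t_def)
    have dims: "dim_vec (w i) = n" "dim_vec s = n" for i using w[of i] s by auto
    \<comment> \<open>Expand the squared distance of the extrapolated point to \<open>s\<close> in two ways: from the new iterate, and from the two preceding ones.\<close>
    have "extrapolate \<alpha> w (Suc k) - s = 1 \<cdot>\<^sub>v p + (-1) \<cdot>\<^sub>v e (Suc k)"
      by (intro eq_vecI) (auto simp: p_def e_def extrapolate_def dims)
    moreover have "extrapolate \<alpha> w (Suc k) - s = (1 + t) \<cdot>\<^sub>v b + (- t) \<cdot>\<^sub>v b'"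
      by (intro eq_vecI) (auto simp: b_def b'_def t_def extrapolate_def dims algebra_simps)
    ultimately have "quad_norm M (1 \<cdot>\<^sub>v p + (-1) \<cdot>\<^sub>v e (Suc k))
        = quad_norm M ((1 + t) \<cdot>\<^sub>v b + (- t) \<cdot>\<^sub>v b')" by simp
    then have eq: "quad_norm M p - 2 * (p \<bullet> (M *\<^sub>v e (Suc k))) + quad_norm M (e (Suc k))
        = (1 + t)\<^sup>2 * quad_norm M b - 2 * (1 + t) * t * (b \<bullet> (M *\<^sub>v b')) + t\<^sup>2 * quad_norm M b'"
      using quad_norm_lincomb[OF Mc Mt pc(1) ek, of 1 "-1"]
        quad_norm_lincomb[OF Mc Mt pc(2,3), of "1 + t" "- t"] by simp
    have "w (Suc k) - w k = 1 \<cdot>\<^sub>v b + (-1) \<cdot>\<^sub>v b'"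
      by (intro eq_vecI) (auto simp: b_def b'_def dims)
    then have delta: "quad_norm M (w (Suc k) - w k)
        = quad_norm M b - 2 * (b \<bullet> (M *\<^sub>v b')) + quad_norm M b'"
      using quad_norm_lincomb[OF Mc Mt pc(2,3), of 1 "-1"] by simp
    have "p \<bullet> (M *\<^sub>v e (Suc k)) \<le> 0" using fejer[OF that, of "Suc k"] by (simp add: p_def e_def)
    with eq have "quad_norm M p + quad_norm M (e (Suc k))
        \<le> quad_norm M b + t * (quad_norm M b - quad_norm M b')
          + t * (1 + t) * quad_norm M (w (Suc k) - w k)"
      unfolding delta by (simp add: algebra_simps power2_eq_square)
    also have "t * (1 + t) * quad_norm M (w (Suc k) - w k) \<le> d k"
    proof -
      have "(1 + t) * (t * quad_norm M (w (Suc k) - w k)) \<le> 2 * (t * quad_norm M (w (Suc k) - w k))"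
        using t Q0 w by (intro mult_right_mono) auto
      then show ?thesis by (simp add: d_def t_def algebra_simps)
    qed
    finally show ?thesis by (simp add: p_def b_def b'_def t_def)
  qed
  have conv: "convergent (\<lambda>k. quad_norm M (w k - s))" if "s \<in> S" for s
  proof (rule inertial_recursion_convergent[where \<alpha> = "\<lambda>k. \<alpha> (Suc k)" and a = a and d = d])
    fix k
    show "0 \<le> quad_norm M (w k - s)" using w S that by (intro Q0) auto
    show "quad_norm M (w (Suc (Suc k)) - s) - quad_norm M (w (Suc k) - s)
      \<le> \<alpha> (Suc k) * (quad_norm M (w (Suc k) - s) - quad_norm M (w k - s)) + d k"
      using step[OF that, of k] Q0[OF e, of "Suc k"] by linarith
  qed (use \<alpha> a d in auto)
  obtain s0 where s0: "s0 \<in> S" using S by auto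
  then have s0c: "s0 \<in> carrier_vec n" using S by auto
  define \<phi> where "\<phi> k = quad_norm M (w k - s0)" for k
  obtain L where L: "\<phi> \<longlonglongrightarrow> L" using conv[OF s0] unfolding convergent_def \<phi>_def[abs_def] by blast
  \<comment> \<open>Every other term of the one-step estimate tends to zero once the distances converge.\<close>
  have e0: "(\<lambda>k. quad_norm M (e k)) \<longlonglongrightarrow> 0"
  proof (rule LIMSEQ_offset[where k = 1], rule tendsto_sandwich[where f = "\<lambda>_. 0"])
    show "\<forall>\<^sub>F k in sequentially. quad_norm M (e (k + 1))
        \<le> (\<phi> (Suc k) - \<phi> (Suc (Suc k))) + \<bar>\<phi> (Suc k) - \<phi> k\<bar> + d k"
    proof (intro always_eventually allI)
      fix k
      have "\<alpha> (Suc k) * (\<phi> (Suc k) - \<phi> k) \<le> \<bar>\<phi> (Suc k) - \<phi> k\<bar>"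
      proof -
        have "\<alpha> (Suc k) * (\<phi> (Suc k) - \<phi> k) \<le> \<alpha> (Suc k) * \<bar>\<phi> (Suc k) - \<phi> k\<bar>"
          using \<alpha>(1) by (intro mult_left_mono) auto
        also have "\<dots> \<le> 1 * \<bar>\<phi> (Suc k) - \<phi> k\<bar>"
          using \<alpha>(2)[of "Suc k"] a by (intro mult_right_mono) auto
        finally show ?thesis by simp
      qed
      then show "quad_norm M (e (k + 1)) \<le> (\<phi> (Suc k) - \<phi> (Suc (Suc k))) + \<bar>\<phi> (Suc k) - \<phi> k\<bar> + d k"
        using step[OF s0, of k] unfolding \<phi>_def by simp
    qed
    have "(\<lambda>k. (\<phi> (Suc k) - \<phi> (Suc (Suc k))) + \<bar>\<phi> (Suc k) - \<phi> k\<bar> + d k) \<longlonglongrightarrow> (L - L) + \<bar>L - L\<bar> + 0"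
      using L LIMSEQ_Suc[OF L] LIMSEQ_Suc[OF LIMSEQ_Suc[OF L]] summable_LIMSEQ_zero[OF d(2)]
      by (intro tendsto_intros)
    then show "(\<lambda>k. (\<phi> (Suc k) - \<phi> (Suc (Suc k))) + \<bar>\<phi> (Suc k) - \<phi> k\<bar> + d k) \<longlonglongrightarrow> 0" by simp
  qed (use Q0 e in auto)
  have e_lim: "limitin (vec_topology n) e (0\<^sub>v n) sequentially" using e e0 by (rule null)
  obtain B where B: "\<And>k. \<phi> k \<le> B"
    using convergent_imp_Bseq[OF convergentI[OF L]] by (metis Bseq_def abs_le_D1 real_norm_def)
  define u where "u k = w (Suc k) - s0" for k
  have u: "u k \<in> carrier_vec n" for k using w s0c by (simp add: u_def)
  have "u k \<bullet> u k \<le> B / \<kappa>" for k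
    using \<kappa>(2)[OF u[of k]] B[of "Suc k"] \<kappa>(1) 
    by (simp add: pos_le_divide_eq u_def \<phi>_def mult.commute)
  then obtain r v where r: "strict_mono r" and lim: "limitin (vec_topology n) (u \<circ> r) v sequentially"
    using bounded_vec_seq_subseq[of u n] u by metis
  have v: "v \<in> carrier_vec n" using lim by (rule limitin_vec_carrier)
  define s where "s = v + s0"
  have sc: "s \<in> carrier_vec n" using v s0c by (simp add: s_def)
  have w_lim: "limitin (vec_topology n) (\<lambda>i. w (Suc (r i))) s sequentially"
  proof -
    have "(\<lambda>k. w (Suc (r k)) $ i) \<longlonglongrightarrow> s $ i" if "i < n" for i
    proof -
      have "(\<lambda>k. u (r k) $ i + s0 $ i) \<longlonglongrightarrow> v $ i + s0 $ i"
        using lim u v that by (intro tendsto_intros) (simp add: limitin_vec_iff)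
      moreover have "w (Suc (r k)) $ i = u (r k) $ i + s0 $ i" for k
        using that s0c by (simp add: u_def)
      ultimately show ?thesis using that s0c by (simp add: s_def)
    qed
    then show ?thesis using w sc by (subst limitin_vec_iff) auto
  qed
  have sS: "s \<in> S"
  proof (rule cluster[OF r w_lim])
    show "limitin (vec_topology n) (\<lambda>i. w (Suc (r i)) - extrapolate \<alpha> w (r i)) (0\<^sub>v n) sequentially"
      using e_lim e LIMSEQ_subseq_LIMSEQ[OF _ r]
      by (subst limitin_vec_iff) (auto simp: limitin_vec_iff e_def[symmetric] o_def)
  qed
  obtain L' where L': "(\<lambda>k. quad_norm M (w k - s)) \<longlonglongrightarrow> L'"
    using conv[OF sS] by (auto simp: convergent_def)
  have "(\<lambda>i. quad_norm M (w (Suc (r i)) - s)) \<longlonglongrightarrow> quad_norm M (s - s)"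
    unfolding quad_norm_def
    by (intro tendsto_scalar_prod_vec[where n = n] limitin_mult_mat_vec[OF Mc]
        limitin_vec_minus w_lim limitin_vec_const) (use w sc Mc in auto)
  moreover have "s - s = 0\<^sub>v n" using sc by auto
  moreover have "quad_norm M (0\<^sub>v n) = 0" using Mc by (simp add: quad_norm_def)
  moreover have "(\<lambda>i. quad_norm M (w (Suc (r i)) - s)) \<longlonglongrightarrow> L'"
    using LIMSEQ_subseq_LIMSEQ[OF LIMSEQ_Suc[OF L'] r] by (simp add: o_def)
  ultimately have "L' = 0" using LIMSEQ_unique by fastforce
  then have z: "limitin (vec_topology n) (\<lambda>k. w k - s) (0\<^sub>v n) sequentially"
    using L' w sc by (intro null) auto
  have "(\<lambda>k. w k $ i) \<longlonglongrightarrow> s $ i" if "i < n" for i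
  proof -
    have "(\<lambda>k. (w k - s) $ i) \<longlonglongrightarrow> 0"
      using z w sc that by (subst (asm) limitin_vec_iff) auto
    then show ?thesis using that sc by (simp add: LIM_zero_iff)
  qed
  then have "limitin (vec_topology n) w s sequentially" using w sc by (subst limitin_vec_iff) auto
  with sS show thesis using e_lim that unfolding e_def by blast
qed

section \<open>Block vectors and block matrices\<close>

lemma distinct_block_index: "distinct (block_index d L)"
  unfolding block_index_def
  by (induction L) (auto simp: distinct_map inj_on_def)

lemma set_block_index: "set (block_index d L) = (SIGMA j:{1..L}. {..<d j})"
  unfolding block_index_def by auto

text \<open>
  Turns sums over positions of a block vector into double sums over blocks and their entries.
\<close>

lemma bij_betw_block_index:
  "bij_betw ((!) (block_index d L)) {..<length (block_index d L)} (SIGMA j:{1..L}. {..<d j})"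
  by (rule bij_betw_nth) (simp_all add: distinct_block_index set_block_index)

lemma block_index_cases:
  assumes "p < length (block_index d L)"
  obtains j a where "block_index d L ! p = (j, a)" "j \<in> {1..L}" "a < d j"
  using assms nth_mem[OF assms] that unfolding set_block_index by blast

lemma block_index_surj:
  assumes "j \<in> {1..L}" "a < d j"
  obtains p where "p < length (block_index d L)" "block_index d L ! p = (j, a)"
proof -
  have "(j, a) \<in> set (block_index d L)" using assms by (simp add: set_block_index)
  then show thesis using that by (auto simp: in_set_conv_nth)
qed

lemma sum_block_index:
  "(\<Sum>p<length (block_index d L). g (block_index d L ! p)) = (\<Sum>j=1..L. \<Sum>a<d j. g (j, a))"
  (is "_ = (\<Sum>j=1..L. \<Sum>a<d j. ?g j a)")
proof -
  have "(\<Sum>p<length (block_index d L). g (block_index d L ! p)) = sum g (SIGMA j:{1..L}. {..<d j})"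
    by (rule sum.reindex_bij_betw[OF bij_betw_block_index])
  also have "\<dots> = (\<Sum>j=1..L. \<Sum>a<d j. g (j, a))"
    by (subst sum.Sigma) auto
  finally show ?thesis .
qed

lemma block_vec_carrier: "block_vec d L v \<in> carrier_vec (length (block_index d L))"
  by (simp add: block_vec_def)

lemma block_vec_index:
  "p < length (block_index d L) \<Longrightarrow> block_index d L ! p = (j, a) \<Longrightarrow> block_vec d L v $ p = v j $ a"
  by (simp add: block_vec_def)

lemma scalar_prod_lessThan: "v \<in> carrier_vec n \<Longrightarrow> u \<bullet> v = (\<Sum>i<n. u $ i * v $ i)"
  by (simp add: scalar_prod_def lessThan_atLeast0)

lemma block_vec_scalar_prod:
  assumes "\<And>j. j \<in> {1..L} \<Longrightarrow> v j \<in> carrier_vec (d j)"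
  shows "block_vec d L u \<bullet> block_vec d L v = (\<Sum>j=1..L. u j \<bullet> v j)"
proof -
  have "block_vec d L u \<bullet> block_vec d L v
      = (\<Sum>p<length (block_index d L). (\<lambda>(j, a). u j $ a * v j $ a) (block_index d L ! p))"
    unfolding scalar_prod_lessThan[OF block_vec_carrier]
    by (intro sum.cong) (auto simp: block_vec_def split: prod.splits)
  also have "\<dots> = (\<Sum>j=1..L. \<Sum>a<d j. u j $ a * v j $ a)"
    by (subst sum_block_index) simp
  also have "\<dots> = (\<Sum>j=1..L. u j \<bullet> v j)"
    using assms by (intro sum.cong refl scalar_prod_lessThan[symmetric])
  finally show ?thesis .
qed

lemma block_mat_mult_vec:
  assumes M: "\<And>i j. i \<in> {1..L} \<Longrightarrow> j \<in> {1..L} \<Longrightarrow> M i j \<in> carrier_mat (d i) (d j)"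
    and v: "\<And>j. j \<in> {1..L} \<Longrightarrow> v j \<in> carrier_vec (d j)"
  shows "block_mat d L M *\<^sub>v block_vec d L v
    = block_vec d L (\<lambda>i. vec (d i) (\<lambda>a. \<Sum>j=1..L. (M i j *\<^sub>v v j) $ a))"
proof (rule eq_vecI)
  fix p
  assume "p < dim_vec (block_vec d L (\<lambda>i. vec (d i) (\<lambda>a. \<Sum>j=1..L. (M i j *\<^sub>v v j) $ a)))"
  then have p: "p < length (block_index d L)" by (simp add: block_vec_def)
  then obtain i a where ia: "block_index d L ! p = (i, a)" "i \<in> {1..L}" "a < d i"
    by (rule block_index_cases)
  have "(block_mat d L M *\<^sub>v block_vec d L v) $ p
      = (\<Sum>q<length (block_index d L). (\<lambda>(j, b). M i j $$ (a, b) * v j $ b) (block_index d L ! q))"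
    using p ia
    by (simp add: block_mat_def scalar_prod_lessThan[OF block_vec_carrier])
      (auto simp: block_vec_def split: prod.splits intro!: sum.cong)
  also have "\<dots> = (\<Sum>j=1..L. \<Sum>b<d j. M i j $$ (a, b) * v j $ b)"
    by (subst sum_block_index) simp
  also have "\<dots> = (\<Sum>j=1..L. (M i j *\<^sub>v v j) $ a)"
  proof (rule sum.cong)
    fix j assume j: "j \<in> {1..L}"
    show "(\<Sum>b<d j. M i j $$ (a, b) * v j $ b) = (M i j *\<^sub>v v j) $ a"
      using M[OF ia(2) j] v[OF j] ia(3) by (auto simp: scalar_prod_lessThan intro!: sum.cong)
  qed simp
  finally show "(block_mat d L M *\<^sub>v block_vec d L v) $ p
      = block_vec d L (\<lambda>i. vec (d i) (\<lambda>a. \<Sum>j=1..L. (M i j *\<^sub>v v j) $ a)) $ p"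
    using p ia by (simp add: block_vec_index)
qed (simp add: block_vec_def block_mat_def)

lemma block_mat_scalar_prod:
  assumes u: "\<And>i. i \<in> {1..L} \<Longrightarrow> u i \<in> carrier_vec (d i)"
    and M: "\<And>i j. i \<in> {1..L} \<Longrightarrow> j \<in> {1..L} \<Longrightarrow> M i j \<in> carrier_mat (d i) (d j)"
    and v: "\<And>j. j \<in> {1..L} \<Longrightarrow> v j \<in> carrier_vec (d j)"
  shows "block_vec d L u \<bullet> (block_mat d L M *\<^sub>v block_vec d L v)
    = (\<Sum>i=1..L. \<Sum>j=1..L. u i \<bullet> (M i j *\<^sub>v v j))"
proof -
  have "u i \<bullet> vec (d i) (\<lambda>a. \<Sum>j=1..L. (M i j *\<^sub>v v j) $ a) = (\<Sum>j=1..L. u i \<bullet> (M i j *\<^sub>v v j))"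
    if i: "i \<in> {1..L}" for i
  proof -
    have "u i \<bullet> vec (d i) (\<lambda>a. \<Sum>j=1..L. (M i j *\<^sub>v v j) $ a)
        = (\<Sum>a<d i. \<Sum>j=1..L. u i $ a * (M i j *\<^sub>v v j) $ a)"
      by (simp add: scalar_prod_lessThan sum_distrib_left)
    also have "\<dots> = (\<Sum>j=1..L. \<Sum>a<d i. u i $ a * (M i j *\<^sub>v v j) $ a)" by (rule sum.swap)
    also have "\<dots> = (\<Sum>j=1..L. u i \<bullet> (M i j *\<^sub>v v j))"
    proof (rule sum.cong)
      fix j assume j: "j \<in> {1..L}"
      have "M i j *\<^sub>v v j \<in> carrier_vec (d i)" by (rule mult_mat_vec_carrier[OF M[OF i j] v[OF j]])
      then show "(\<Sum>a<d i. u i $ a * (M i j *\<^sub>v v j) $ a) = u i \<bullet> (M i j *\<^sub>v v j)"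
        by (simp add: scalar_prod_lessThan del: index_mult_mat_vec)
    qed simp
    finally show ?thesis .
  qed
  then have "(\<Sum>i=1..L. u i \<bullet> vec (d i) (\<lambda>a. \<Sum>j=1..L. (M i j *\<^sub>v v j) $ a))
      = (\<Sum>i=1..L. \<Sum>j=1..L. u i \<bullet> (M i j *\<^sub>v v j))"
    by (intro sum.cong refl)
  moreover have "block_mat d L M *\<^sub>v block_vec d L v
      = block_vec d L (\<lambda>i. vec (d i) (\<lambda>a. \<Sum>j=1..L. (M i j *\<^sub>v v j) $ a))"
    using M v by (rule block_mat_mult_vec)
  moreover have "block_vec d L u \<bullet> block_vec d L (\<lambda>i. vec (d i) (\<lambda>a. \<Sum>j=1..L. (M i j *\<^sub>v v j) $ a))
      = (\<Sum>i=1..L. u i \<bullet> vec (d i) (\<lambda>a. \<Sum>j=1..L. (M i j *\<^sub>v v j) $ a))"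
    by (rule block_vec_scalar_prod) (rule vec_carrier)
  ultimately show ?thesis by (simp only:)
qed

lemma dims_simps [simp]: "j \<le> l \<Longrightarrow> dims l m n j = n j" "dims l m n (Suc l) = m"
  by (simp_all add: dims_def)

lemma length_block_index_dims:
  "length (block_index (dims l m n) (Suc l)) = (\<Sum>j=1..l. n j) + m"
  by (simp add: length_block_index)

lemma point_minus:
  assumes "\<And>j. j \<in> {1..l} \<Longrightarrow> y j \<in> carrier_vec (n j)" "t \<in> carrier_vec m"
  shows "point l m n x z - point l m n y t = point l m n (\<lambda>j. x j - y j) (z - t)"
proof (rule eq_vecI)
  fix p assume "p < dim_vec (point l m n (\<lambda>j. x j - y j) (z - t))"
  then have p: "p < length (block_index (dims l m n) (Suc l))" by (simp add: point_def block_vec_def)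
  then obtain j a where ja: "block_index (dims l m n) (Suc l) ! p = (j, a)" "j \<in> {1..Suc l}"
    "a < dims l m n j" by (rule block_index_cases)
  have "dim_vec (block_vec (dims l m n) (Suc l) v) = length (block_index (dims l m n) (Suc l))" for v
    by (simp add: block_vec_def)
  then show "(point l m n x z - point l m n y t) $ p = point l m n (\<lambda>j. x j - y j) (z - t) $ p"
    using assms(1)[of j] assms(2) p ja
    by (cases "j \<le> l") (auto simp: point_def block_vec_index not_le le_Suc_eq)
qed (simp add: point_def block_vec_def)

lemma point_scalar_prod:
  assumes "\<And>j. j \<in> {1..l} \<Longrightarrow> y j \<in> carrier_vec (n j)" "t \<in> carrier_vec m"
  shows "point l m n x z \<bullet> point l m n y t = (\<Sum>j=1..l. x j \<bullet> y j) + z \<bullet> t"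
  unfolding point_def using assms
  by (subst block_vec_scalar_prod) (auto simp: dims_def)

text \<open>
  Lets a limit of block vectors, which is only known to be a vector of the right length, be split
  into blocks again.
\<close>

lemma point_surj:
  assumes v: "v \<in> carrier_vec ((\<Sum>j=1..l. n j) + m)"
  obtains x z where "\<And>j. j \<in> {1..l} \<Longrightarrow> x j \<in> carrier_vec (n j)" "z \<in> carrier_vec m"
    "v = point l m n x z"
proof -
  let ?I = "block_index (dims l m n) (Suc l)"
  define pos where "pos = the_inv_into {..<length ?I} ((!) ?I)"
  have pos: "pos (?I ! p) = p" if "p < length ?I" for p
    unfolding pos_def using that
    by (intro the_inv_into_f_f bij_betw_imp_inj_on[OF bij_betw_block_index]) auto
  define y where "y j = vec (dims l m n j) (\<lambda>a. v $ pos (j, a))" for j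
  have "v = point l m n y (y (Suc l))"
  proof (rule eq_vecI)
    fix p assume "p < dim_vec (point l m n y (y (Suc l)))"
    then have p: "p < length ?I" by (simp add: point_def block_vec_def)
    then obtain j a where ja: "?I ! p = (j, a)" "j \<in> {1..Suc l}" "a < dims l m n j"
      by (rule block_index_cases)
    then show "v $ p = point l m n y (y (Suc l)) $ p"
      using p pos[OF p]
      by (cases "j \<le> l") (auto simp: point_def block_vec_index y_def not_le le_Suc_eq)
  qed (use v in \<open>simp add: point_def block_vec_def length_block_index_dims\<close>)
  moreover have "y j \<in> carrier_vec (n j)" if "j \<in> {1..l}" for j using that by (simp add: y_def)
  moreover have "y (Suc l) \<in> carrier_vec m" by (simp add: y_def)
  ultimately show thesis using that by blast
qed

lemma limitin_point_blocks:
  assumes x: "\<And>k j. j \<in> {1..l} \<Longrightarrow> x k j \<in> carrier_vec (n j)" "\<And>k. z k \<in> carrier_vec m"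
    and y: "\<And>j. j \<in> {1..l} \<Longrightarrow> y j \<in> carrier_vec (n j)" "t \<in> carrier_vec m"
    and lim: "limitin (vec_topology ((\<Sum>j=1..l. n j) + m)) (\<lambda>k. point l m n (x k) (z k))
      (point l m n y t) sequentially"
  shows "j \<in> {1..l} \<Longrightarrow> limitin (vec_topology (n j)) (\<lambda>k. x k j) (y j) sequentially"
    and "limitin (vec_topology m) z t sequentially"
proof -
  have coord: "(\<lambda>k. point l m n (x k) (z k) $ p) \<longlonglongrightarrow> point l m n y t $ p"
    if "p < length (block_index (dims l m n) (Suc l))" for p
    using lim that point_carrier unfolding length_block_index_dims
    by (subst (asm) limitin_vec_iff) auto
  show "limitin (vec_topology (n j)) (\<lambda>k. x k j) (y j) sequentially" if j: "j \<in> {1..l}"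
  proof -
    have "(\<lambda>k. x k j $ a) \<longlonglongrightarrow> y j $ a" if "a < n j" for a
    proof -
      have "j \<in> {1..Suc l}" "a < dims l m n j" using j that by auto
      then obtain p where p: "p < length (block_index (dims l m n) (Suc l))"
        "block_index (dims l m n) (Suc l) ! p = (j, a)" by (rule block_index_surj)
      then show ?thesis using coord[OF p(1)] j by (simp add: point_def block_vec_index)
    qed
    then show ?thesis using x y j by (subst limitin_vec_iff) auto
  qed
  have "(\<lambda>k. z k $ a) \<longlonglongrightarrow> t $ a" if "a < m" for a
  proof -
    have "Suc l \<in> {1..Suc l}" "a < dims l m n (Suc l)" using that by auto
    then obtain p where p: "p < length (block_index (dims l m n) (Suc l))"
      "block_index (dims l m n) (Suc l) ! p = (Suc l, a)" by (rule block_index_surj)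
    then show ?thesis using coord[OF p(1)] by (simp add: point_def block_vec_index)
  qed
  then show "limitin (vec_topology m) z t sequentially" using x y by (subst limitin_vec_iff) auto
qed

lemma extrapolate_point:
  assumes "\<And>k j. j \<in> {1..l} \<Longrightarrow> x k j \<in> carrier_vec (n j)" "\<And>k. z k \<in> carrier_vec m"
  shows "extrapolate \<alpha> (\<lambda>k. point l m n (x k) (z k)) k
    = point l m n (\<lambda>j. extrapolate \<alpha> (\<lambda>k. x k j) k) (extrapolate \<alpha> z k)"
proof (rule eq_vecI)
  fix p assume "p < dim_vec (point l m n (\<lambda>j. extrapolate \<alpha> (\<lambda>k. x k j) k) (extrapolate \<alpha> z k))"
  then have p: "p < length (block_index (dims l m n) (Suc l))" by (simp add: point_def block_vec_def)
  then obtain j a where ja: "block_index (dims l m n) (Suc l) ! p = (j, a)" "j \<in> {1..Suc l}"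
    "a < dims l m n j" by (rule block_index_cases)
  have "dim_vec (block_vec (dims l m n) (Suc l) v) = length (block_index (dims l m n) (Suc l))" for v
    by (simp add: block_vec_def)
  moreover have "dim_vec (z i) = m" for i using assms(2)[of i] by simp
  moreover have "j \<in> {1..l} \<Longrightarrow> dim_vec (x i j) = n j" for i using assms(1)[of j i] by simp
  ultimately show "extrapolate \<alpha> (\<lambda>k. point l m n (x k) (z k)) k $ p
      = point l m n (\<lambda>j. extrapolate \<alpha> (\<lambda>k. x k j) k) (extrapolate \<alpha> z k) $ p"
    using p ja
    by (cases "j \<le> l") (auto simp: extrapolate_def point_def block_vec_index not_le le_Suc_eq)
qed (simp add: extrapolate_def point_def block_vec_def)

lemma finsum_vec_carrier:
  "(\<And>j. j \<in> J \<Longrightarrow> p j \<in> carrier_vec m) \<Longrightarrow> finsum_vec TYPE(real) m p J \<in> carrier_vec m"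
  by (rule finsum_vec_closed) auto

lemma finsum_vec_scalar_prod:
  assumes "finite J" "\<And>j. j \<in> J \<Longrightarrow> p j \<in> carrier_vec m" "z \<in> carrier_vec m"
  shows "finsum_vec TYPE(real) m p J \<bullet> z = (\<Sum>j\<in>J. p j \<bullet> z)"
proof -
  have "finsum_vec TYPE(real) m p J \<bullet> z = (\<Sum>i<m. \<Sum>j\<in>J. p j $ i * z $ i)"
    using assms by (simp add: scalar_prod_lessThan index_finsum_vec sum_distrib_right)
  also have "\<dots> = (\<Sum>j\<in>J. \<Sum>i<m. p j $ i * z $ i)" by (rule sum.swap)
  finally show ?thesis using assms(3) by (simp add: scalar_prod_lessThan)
qed

lemma mult_mat_vec_scalar_prod:
  fixes M :: "real mat"
  assumes "M \<in> carrier_mat m n" "x \<in> carrier_vec n" "y \<in> carrier_vec m"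
  shows "x \<bullet> (transpose_mat M *\<^sub>v y) = (M *\<^sub>v x) \<bullet> y"
proof -
  have "x \<bullet> (transpose_mat M *\<^sub>v y) = (transpose_mat M *\<^sub>v y) \<bullet> x"
    using assms by (intro comm_scalar_prod[of _ n]) auto
  also have "\<dots> = y \<bullet> (M *\<^sub>v x)" using assms by (intro transpose_vec_mult_scalar)
  also have "\<dots> = (M *\<^sub>v x) \<bullet> y" using assms by (intro comm_scalar_prod[of _ m]) auto
  finally show ?thesis .
qed

lemma smult_mat_mult_vec:
  "v \<in> carrier_vec (dim_col M) \<Longrightarrow> (c \<cdot>\<^sub>m M) *\<^sub>v v = c \<cdot>\<^sub>v ((M :: real mat) *\<^sub>v v)"
  by (intro eq_vecI) auto

lemma zero_mat_mult_vec: "v \<in> carrier_vec b \<Longrightarrow> 0\<^sub>m a b *\<^sub>v (v :: real vec) = 0\<^sub>v a"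
  by (intro eq_vecI) auto

text \<open>
  The product with the Gram matrix is evaluated from the right, so that inner products with it
  become inner products of images under \<open>M\<close>.
\<close>

lemma gram_mult_vec:
  fixes M :: "real mat"
  assumes "M \<in> carrier_mat r k" "v \<in> carrier_vec k"
  shows "(c \<cdot>\<^sub>m (transpose_mat M * M)) *\<^sub>v v = c \<cdot>\<^sub>v (transpose_mat M *\<^sub>v (M *\<^sub>v v))"
  using assms by (subst smult_mat_mult_vec) auto

section \<open>The metric of the method\<close>

text \<open>
  The bilinear form of the matrix of the method at the points \<open>(x; z)\<close> and \<open>(y; t)\<close>,
  multiplied out block by block.
\<close>

definition G_bilinear :: "nat \<Rightarrow> (nat \<Rightarrow> real mat) \<Rightarrow> (nat \<Rightarrow> real mat) \<Rightarrow> real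
    \<Rightarrow> (nat \<Rightarrow> real vec) \<Rightarrow> real vec \<Rightarrow> (nat \<Rightarrow> real vec) \<Rightarrow> real vec \<Rightarrow> real" where
  "G_bilinear l A H \<beta> x z y t = (\<Sum>j=1..l. x j \<bullet> (H j *\<^sub>v y j))
     + (\<Sum>j=2..l. \<beta> * ((A j *\<^sub>v x j) \<bullet> (A j *\<^sub>v y j)) - (A j *\<^sub>v x j) \<bullet> t - (A j *\<^sub>v y j) \<bullet> z)
     + (z \<bullet> t) / \<beta>"

context
  fixes l m :: nat and n :: "nat \<Rightarrow> nat" and A H :: "nat \<Rightarrow> real mat" and \<beta> :: real
  assumes l: "l \<ge> 2"
    and A: "\<And>j. j \<in> {1..l} \<Longrightarrow> A j \<in> carrier_mat m (n j)"
    and H: "\<And>j. j \<in> {1..l} \<Longrightarrow> pos_semidef (n j) (H j)"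
    and \<beta>: "\<beta> > 0"
begin

lemma H_carrier: "j \<in> {1..l} \<Longrightarrow> H j \<in> carrier_mat (n j) (n j)"
  using H by (simp add: pos_semidef_def)

lemma G_block_simps:
  "G_block l m n A H \<beta> 1 1 = H 1"
  "G_block l m n A H \<beta> (Suc l) (Suc l) = (1 / \<beta>) \<cdot>\<^sub>m 1\<^sub>m m"
  "G_block l m n A H \<beta> 1 (Suc l) = 0\<^sub>m (n 1) m"
  "G_block l m n A H \<beta> (Suc l) 1 = 0\<^sub>m m (n 1)"
  "i \<in> {2..l} \<Longrightarrow> G_block l m n A H \<beta> i i = \<beta> \<cdot>\<^sub>m (transpose_mat (A i) * A i) + H i"
  "i \<in> {2..l} \<Longrightarrow> G_block l m n A H \<beta> i (Suc l) = - transpose_mat (A i)"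
  "i \<in> {2..l} \<Longrightarrow> G_block l m n A H \<beta> (Suc l) i = - A i"
  "i \<in> {2..l} \<Longrightarrow> G_block l m n A H \<beta> 1 i = 0\<^sub>m (n 1) (n i)"
  "i \<in> {2..l} \<Longrightarrow> G_block l m n A H \<beta> i 1 = 0\<^sub>m (n i) (n 1)"
  "i \<in> {2..l} \<Longrightarrow> j \<in> {2..l} \<Longrightarrow> i \<noteq> j \<Longrightarrow> G_block l m n A H \<beta> i j = 0\<^sub>m (n i) (n j)"
  using l by (auto simp: G_block_def dims_def)

lemma block_position_cases:
  assumes "i \<in> {1..Suc l}"
  obtains "i = 1" | "i = Suc l" | "i \<in> {2..l}"
  using assms by (cases "i = 1"; cases "i = Suc l") auto

lemma G_block_carrier:
  assumes i: "i \<in> {1..Suc l}" and j: "j \<in> {1..Suc l}"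
  shows "G_block l m n A H \<beta> i j \<in> carrier_mat (dims l m n i) (dims l m n j)"
proof -
  have mid: "A k \<in> carrier_mat m (n k)" "H k \<in> carrier_mat (n k) (n k)" "dims l m n k = n k"
    if "k \<in> {2..l}" for k
    using A H_carrier that by auto
  have one: "H 1 \<in> carrier_mat (n 1) (n 1)" "dims l m n 1 = n 1" using H_carrier[of 1] l by auto
  show ?thesis
  proof (rule block_position_cases[OF i])
    assume i': "i = 1"
    show ?thesis
      by (rule block_position_cases[OF j]; simp only: i' G_block_simps one mid dims_simps) auto
  next
    assume i': "i = Suc l"
    show ?thesis
      by (rule block_position_cases[OF j]; simp only: i' G_block_simps one mid dims_simps)
        (auto intro: mid)
  next
    assume i': "i \<in> {2..l}"
    show ?thesis
    proof (cases "i = j")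
      case True
      then show ?thesis using i' mid[OF i'] by (simp only: G_block_simps) auto
    next
      case False
      show ?thesis
      proof (rule block_position_cases[OF j])
        assume "j \<in> {2..l}"
        then show ?thesis using i' False by (simp add: G_block_simps mid)
      next
        assume "j = 1"
        then show ?thesis using i' by (simp only: G_block_simps one mid) auto
      next
        assume "j = Suc l"
        then show ?thesis
          by (simp only: G_block_simps(6)[OF i'] mid(3)[OF i'] dims_simps) (use mid(1)[OF i'] in auto)
      qed
    qed
  qed
qed

lemma G_block_transpose:
  assumes i: "i \<in> {1..Suc l}" and j: "j \<in> {1..Suc l}"
  shows "transpose_mat (G_block l m n A H \<beta> i j) = G_block l m n A H \<beta> j i"
proof -
  have HT: "transpose_mat (H k) = H k" if "k \<in> {1..l}" for k
    using H[OF that] by (simp add: pos_semidef_def)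
  have H1: "transpose_mat (H 1) = H 1" using HT[of 1] l by simp
  have diag: "transpose_mat (\<beta> \<cdot>\<^sub>m (transpose_mat (A k) * A k) + H k)
      = \<beta> \<cdot>\<^sub>m (transpose_mat (A k) * A k) + H k"
    if "k \<in> {2..l}" for k
  proof -
    have k: "k \<in> {1..l}" using that by auto
    have "transpose_mat (transpose_mat (A k) * A k) = transpose_mat (A k) * A k"
      using A[OF k] by (subst transpose_mult) auto
    moreover have "transpose_mat (\<beta> \<cdot>\<^sub>m B) = \<beta> \<cdot>\<^sub>m transpose_mat B" for B
      by (intro eq_matI) auto
    ultimately have "transpose_mat (\<beta> \<cdot>\<^sub>m (transpose_mat (A k) * A k)) = \<beta> \<cdot>\<^sub>m (transpose_mat (A k) * A k)"
      by simp
    then show ?thesis using A[OF k] H_carrier[OF k] HT[OF k]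
      by (subst transpose_add[of _ "n k" "n k"]) auto
  qed
  have neg: "transpose_mat (- M) = - transpose_mat M" for M :: "real mat"
    by (intro eq_matI) auto
  have unit: "transpose_mat (((1::real) / \<beta>) \<cdot>\<^sub>m 1\<^sub>m m) = (1 / \<beta>) \<cdot>\<^sub>m 1\<^sub>m m"
    by (intro eq_matI) auto
  note rules = G_block_simps H1 diag neg unit transpose_transpose zero_transpose_mat
  show ?thesis
  proof (rule block_position_cases[OF i])
    assume i': "i = 1"
    show ?thesis
      by (rule block_position_cases[OF j]; simp only: i' rules)
  next
    assume i': "i = Suc l"
    show ?thesis
      by (rule block_position_cases[OF j]; simp only: i' rules)
  next
    assume i': "i \<in> {2..l}"
    show ?thesis
    proof (cases "i = j")
      case True
      then show ?thesis using i' by (simp only: rules)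
    next
      case False
      then show ?thesis
        by (rule_tac block_position_cases[OF j]; simp only: i' False[symmetric] rules simp_thms)
    qed
  qed
qed

lemma G_mat_carrier: "G_mat l m n A H \<beta> \<in> carrier_mat ((\<Sum>j=1..l. n j) + m) ((\<Sum>j=1..l. n j) + m)"
  unfolding G_mat_def block_mat_def length_block_index_dims by simp

lemma G_mat_symmetric: "transpose_mat (G_mat l m n A H \<beta>) = G_mat l m n A H \<beta>"
proof (rule eq_matI)
  let ?I = "block_index (dims l m n) (Suc l)"
  fix p q assume "p < dim_row (G_mat l m n A H \<beta>)" "q < dim_col (G_mat l m n A H \<beta>)"
  then have pq: "p < length ?I" "q < length ?I" by (auto simp: G_mat_def block_mat_def)
  from pq(1) obtain i a where ia: "?I ! p = (i, a)" "i \<in> {1..Suc l}" "a < dims l m n i"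
    by (rule block_index_cases)
  from pq(2) obtain j b where jb: "?I ! q = (j, b)" "j \<in> {1..Suc l}" "b < dims l m n j"
    by (rule block_index_cases)
  have "transpose_mat (G_block l m n A H \<beta> i j) $$ (b, a) = G_block l m n A H \<beta> i j $$ (a, b)"
    using G_block_carrier[OF ia(2) jb(2)] ia(3) jb(3) by auto
  then show "transpose_mat (G_mat l m n A H \<beta>) $$ (p, q) = G_mat l m n A H \<beta> $$ (p, q)"
    using pq ia jb by (simp add: G_mat_def block_mat_def G_block_transpose)
qed (simp_all add: G_mat_def block_mat_def)

text \<open>
  Of the products of blocks only those on the diagonal and those linking a later primal block
  with the multiplier survive.
\<close>

lemma point_G_mat:
  assumes x: "\<And>j. j \<in> {1..l} \<Longrightarrow> x j \<in> carrier_vec (n j)" and z: "z \<in> carrier_vec m"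
    and y: "\<And>j. j \<in> {1..l} \<Longrightarrow> y j \<in> carrier_vec (n j)" and t: "t \<in> carrier_vec m"
  shows "point l m n x z \<bullet> (G_mat l m n A H \<beta> *\<^sub>v point l m n y t) = G_bilinear l A H \<beta> x z y t"
proof -
  let ?G = "G_block l m n A H \<beta>"
  define u v where "u j = (if j \<le> l then x j else z)" and "v j = (if j \<le> l then y j else t)" for j
  define g where "g i j = u i \<bullet> (?G i j *\<^sub>v v j)" for i j
  have uv: "u j \<in> carrier_vec (dims l m n j)" "v j \<in> carrier_vec (dims l m n j)"
    if "j \<in> {1..Suc l}" for j
    using that x y z t by (auto simp: u_def v_def dims_def)
  have "point l m n x z \<bullet> (G_mat l m n A H \<beta> *\<^sub>v point l m n y t) = (\<Sum>i=1..Suc l. \<Sum>j=1..Suc l. g i j)"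
    unfolding point_def G_mat_def g_def u_def[symmetric] v_def[symmetric]
    by (rule block_mat_scalar_prod) (simp_all add: uv G_block_carrier)
  also have "{1..Suc l} = insert 1 (insert (Suc l) {2..l})" using l by auto
  also have "(\<Sum>i\<in>insert 1 (insert (Suc l) {2..l}). \<Sum>j\<in>insert 1 (insert (Suc l) {2..l}). g i j)
     = g 1 1 + g 1 (Suc l) + (\<Sum>j=2..l. g 1 j) + (g (Suc l) 1 + g (Suc l) (Suc l) + (\<Sum>j=2..l. g (Suc l) j))
       + (\<Sum>i=2..l. g i 1 + g i (Suc l) + (\<Sum>j=2..l. g i j))"
    using l by (simp add: algebra_simps)
  also have "g 1 (Suc l) = 0"
    using uv[of 1] uv[of "Suc l"] l unfolding g_def G_block_simps by (auto simp: zero_mat_mult_vec)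
  also have "g (Suc l) 1 = 0"
    using uv[of 1] uv[of "Suc l"] l unfolding g_def G_block_simps by (auto simp: zero_mat_mult_vec)
  also have "(\<Sum>j=2..l. g 1 j) = 0"
  proof (intro sum.neutral ballI)
    fix j assume j: "j \<in> {2..l}"
    show "g 1 j = 0"
      using uv[of 1] uv[of j] l j unfolding g_def G_block_simps(8)[OF j] by (auto simp: zero_mat_mult_vec)
  qed
  also have "g 1 1 = x 1 \<bullet> (H 1 *\<^sub>v y 1)" using l unfolding g_def G_block_simps by (simp add: u_def v_def)
  also have "g (Suc l) (Suc l) = (z \<bullet> t) / \<beta>"
    using l z t unfolding g_def G_block_simps
    by (simp add: u_def v_def smult_mat_mult_vec)
  also have "(\<Sum>j=2..l. g (Suc l) j) = (\<Sum>j=2..l. - ((A j *\<^sub>v y j) \<bullet> z))"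
  proof (rule sum.cong)
    fix j assume j: "j \<in> {2..l}"
    then have "A j \<in> carrier_mat m (n j)" "y j \<in> carrier_vec (n j)" using A y by auto
    then show "g (Suc l) j = - ((A j *\<^sub>v y j) \<bullet> z)"
      using j z l comm_scalar_prod[OF z, of "A j *\<^sub>v y j"]
      unfolding g_def G_block_simps(7)[OF j] by (auto simp: u_def v_def)
  qed simp
  also have "(\<Sum>i=2..l. g i 1 + g i (Suc l) + (\<Sum>j=2..l. g i j))
    = (\<Sum>i=2..l. x i \<bullet> (H i *\<^sub>v y i) + \<beta> * ((A i *\<^sub>v x i) \<bullet> (A i *\<^sub>v y i)) - (A i *\<^sub>v x i) \<bullet> t)"
  proof (rule sum.cong)
    fix i assume i: "i \<in> {2..l}"
    then have i': "i \<in> {1..l}" by auto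
    have Ai: "A i \<in> carrier_mat m (n i)" and Hi: "H i \<in> carrier_mat (n i) (n i)"
      and xi: "x i \<in> carrier_vec (n i)" and yi: "y i \<in> carrier_vec (n i)"
      using i' A H_carrier x y by auto
    have "g i 1 = 0" using i uv[of 1] uv[of i] l unfolding g_def G_block_simps(9)[OF i] by (auto simp: zero_mat_mult_vec)
    moreover have "g i (Suc l) = - ((A i *\<^sub>v x i) \<bullet> t)"
      using i l t xi Ai mult_mat_vec_scalar_prod[OF Ai xi t]
      unfolding g_def G_block_simps(6)[OF i] by (auto simp: u_def v_def)
    moreover have "(\<Sum>j=2..l. g i j) = g i i"
    proof (rule sum.mono_neutral_right[of _ "{i}", THEN trans])
      show "\<forall>j\<in>{2..l} - {i}. g i j = 0"
      proof
        fix j assume j: "j \<in> {2..l} - {i}"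
        then have "G_block l m n A H \<beta> i j = 0\<^sub>m (n i) (n j)"
          using i by (intro G_block_simps) auto
        then show "g i j = 0" using i j uv[of j] uv[of i] by (auto simp: g_def zero_mat_mult_vec)
      qed
    qed (use i in auto)
    moreover have "g i i = x i \<bullet> (H i *\<^sub>v y i) + \<beta> * ((A i *\<^sub>v x i) \<bullet> (A i *\<^sub>v y i))"
    proof -
      have AA: "transpose_mat (A i) * A i \<in> carrier_mat (n i) (n i)" using Ai by auto
      have "g i i = x i \<bullet> ((\<beta> \<cdot>\<^sub>m (transpose_mat (A i) * A i) + H i) *\<^sub>v y i)"
        using i unfolding g_def G_block_simps(5)[OF i] by (simp add: u_def v_def)
      also have "(\<beta> \<cdot>\<^sub>m (transpose_mat (A i) * A i) + H i) *\<^sub>v y i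
          = \<beta> \<cdot>\<^sub>v (transpose_mat (A i) *\<^sub>v (A i *\<^sub>v y i)) + H i *\<^sub>v y i"
        using Ai Hi yi AA
        by (subst add_mult_distrib_mat_vec[of _ "n i" "n i"]) (auto simp: gram_mult_vec[OF Ai yi])
      also have "x i \<bullet> (\<beta> \<cdot>\<^sub>v (transpose_mat (A i) *\<^sub>v (A i *\<^sub>v y i)) + H i *\<^sub>v y i)
          = \<beta> * (x i \<bullet> (transpose_mat (A i) *\<^sub>v (A i *\<^sub>v y i))) + x i \<bullet> (H i *\<^sub>v y i)"
        using Ai Hi yi xi by (subst scalar_prod_add_distrib[of _ "n i"]) auto
      also have "x i \<bullet> (transpose_mat (A i) *\<^sub>v (A i *\<^sub>v y i)) = (A i *\<^sub>v x i) \<bullet> (A i *\<^sub>v y i)"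
        using Ai xi yi by (intro mult_mat_vec_scalar_prod) auto
      finally show ?thesis by simp
    qed
    ultimately show "g i 1 + g i (Suc l) + (\<Sum>j=2..l. g i j)
        = x i \<bullet> (H i *\<^sub>v y i) + \<beta> * ((A i *\<^sub>v x i) \<bullet> (A i *\<^sub>v y i)) - (A i *\<^sub>v x i) \<bullet> t" by simp
  qed simp
  finally have "point l m n x z \<bullet> (G_mat l m n A H \<beta> *\<^sub>v point l m n y t)
    = x 1 \<bullet> (H 1 *\<^sub>v y 1) + ((z \<bullet> t) / \<beta> + (\<Sum>j=2..l. - ((A j *\<^sub>v y j) \<bullet> z)))
      + (\<Sum>i=2..l. x i \<bullet> (H i *\<^sub>v y i) + \<beta> * ((A i *\<^sub>v x i) \<bullet> (A i *\<^sub>v y i)) - (A i *\<^sub>v x i) \<bullet> t)"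
    by simp
  moreover have "{1..l} = insert 1 {2..l}" using l by auto
  ultimately show ?thesis
    by (simp add: G_bilinear_def sum.distrib sum_subtractf sum_negf)
qed

text \<open>
  Write \<open>p j = A j x j\<close> and \<open>s\<close> for the sum of the \<open>p j\<close> over the later blocks. The hypothesis on
  \<open>H j\<close> leaves positive remainders \<open>R j\<close> and adds \<open>\<beta> (l - 2) \<parallel>p j\<parallel>\<^sup>2\<close> to the term
  \<open>\<beta> \<parallel>p j\<parallel>\<^sup>2\<close> that is present in the matrix. The total \<open>\<beta> (l - 1) \<Sum> \<parallel>p j\<parallel>\<^sup>2\<close> dominates
  \<open>\<beta> \<parallel>s\<parallel>\<^sup>2\<close> by the Cauchy--Schwarz inequality for \<open>l - 1\<close> summands, and
  \<open>\<beta> \<parallel>s\<parallel>\<^sup>2 - 2 \<langle>s, z\<rangle> + \<parallel>z\<parallel>\<^sup>2 / \<beta>\<close> is a square. If all \<open>x j\<close> vanish, only \<open>\<parallel>z\<parallel>\<^sup>2 / \<beta>\<close> is left.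
\<close>

lemma G_mat_pos_def:
  assumes H1: "pos_def (n 1) (H 1)"
    and Hj: "\<And>j. j \<in> {2..l} \<Longrightarrow>
      pos_def (n j) (H j - (\<beta> * (real l - 2)) \<cdot>\<^sub>m (transpose_mat (A j) * A j))"
  shows "pos_def ((\<Sum>j=1..l. n j) + m) (G_mat l m n A H \<beta>)"
  unfolding pos_def_def
proof (intro conjI ballI impI G_mat_carrier G_mat_symmetric)
  fix u :: "real vec" assume u: "u \<in> carrier_vec ((\<Sum>j=1..l. n j) + m)" "u \<noteq> 0\<^sub>v ((\<Sum>j=1..l. n j) + m)"
  from point_surj[OF u(1)] obtain x z where
    x: "\<And>j. j \<in> {1..l} \<Longrightarrow> x j \<in> carrier_vec (n j)" and z: "z \<in> carrier_vec m"
    and ux: "u = point l m n x z" by metis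
  define R where "R j = (if j = 1 then x 1 \<bullet> (H 1 *\<^sub>v x 1)
    else x j \<bullet> (H j *\<^sub>v x j) - \<beta> * (real l - 2) * ((A j *\<^sub>v x j) \<bullet> (A j *\<^sub>v x j)))" for j
  have R: "x j \<noteq> 0\<^sub>v (n j) \<Longrightarrow> 0 < R j" "x j = 0\<^sub>v (n j) \<Longrightarrow> R j = 0" if j: "j \<in> {1..l}" for j
  proof -
    have Aj: "A j \<in> carrier_mat m (n j)" and Hc: "H j \<in> carrier_mat (n j) (n j)"
      and xj: "x j \<in> carrier_vec (n j)" using j A H_carrier x by auto
    have "A j *\<^sub>v 0\<^sub>v (n j) = 0\<^sub>v m" using Aj by (intro eq_vecI) auto
    then show "R j = 0" if "x j = 0\<^sub>v (n j)" using that Hc by (auto simp: R_def)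
    show "0 < R j" if ne: "x j \<noteq> 0\<^sub>v (n j)"
    proof (cases "j = 1")
      case True
      then show ?thesis using H1 ne xj by (simp add: R_def pos_def_def)
    next
      case False
      then have j2: "j \<in> {2..l}" using j by auto
      define c where "c = \<beta> * (real l - 2)"
      have AA: "transpose_mat (A j) * A j \<in> carrier_mat (n j) (n j)" using Aj by auto
      have "0 < x j \<bullet> ((H j - c \<cdot>\<^sub>m (transpose_mat (A j) * A j)) *\<^sub>v x j)"
        using Hj[OF j2] ne xj by (simp add: pos_def_def c_def)
      also have "(H j - c \<cdot>\<^sub>m (transpose_mat (A j) * A j)) *\<^sub>v x j
          = H j *\<^sub>v x j - c \<cdot>\<^sub>v (transpose_mat (A j) *\<^sub>v (A j *\<^sub>v x j))"
        using Aj Hc xj AA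
        by (subst minus_mult_distrib_mat_vec[of _ "n j" "n j"]) (auto simp: gram_mult_vec[OF Aj xj])
      also have "x j \<bullet> \<dots> = x j \<bullet> (H j *\<^sub>v x j) - c * (x j \<bullet> (transpose_mat (A j) *\<^sub>v (A j *\<^sub>v x j)))"
        using Aj Hc xj by (subst scalar_prod_minus_distrib[of _ "n j"]) auto
      also have "x j \<bullet> (transpose_mat (A j) *\<^sub>v (A j *\<^sub>v x j)) = (A j *\<^sub>v x j) \<bullet> (A j *\<^sub>v x j)"
        using Aj xj by (intro mult_mat_vec_scalar_prod) auto
      finally show ?thesis using False by (simp add: R_def c_def)
    qed
  qed
  have R0: "0 \<le> R j" if "j \<in> {1..l}" for j using R[OF that] by (cases "x j = 0\<^sub>v (n j)") auto
  define p where "p j = A j *\<^sub>v x j" for j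
  have p: "p j \<in> carrier_vec m" if "j \<in> {2..l}" for j
    using A[of j] x[of j] that by (auto simp: p_def)
  define s where "s = finsum_vec TYPE(real) m p {2..l}"
  have s: "s \<in> carrier_vec m" unfolding s_def by (intro finsum_vec_carrier p)
  have sz: "s \<bullet> z = (\<Sum>j=2..l. p j \<bullet> z)" unfolding s_def using p z by (intro finsum_vec_scalar_prod) auto
  have CS: "s \<bullet> s \<le> (real l - 1) * (\<Sum>j=2..l. p j \<bullet> p j)"
  proof -
    have "s \<bullet> s = (\<Sum>i<m. (\<Sum>j=2..l. p j $ i)\<^sup>2)"
      using s p by (simp add: scalar_prod_lessThan power2_eq_square s_def index_finsum_vec)
    also have "\<dots> \<le> (\<Sum>i<m. (\<Sum>j=2..l. (p j $ i)\<^sup>2) * real (card {2..l}))"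
      by (intro sum_mono sum_squared_le_sum_of_squares)
    also have "\<dots> = real (card {2..l}) * (\<Sum>j=2..l. \<Sum>i<m. (p j $ i)\<^sup>2)"
      by (subst sum.swap) (simp add: sum_distrib_left sum_distrib_right mult.commute)
    also have "(\<Sum>j=2..l. \<Sum>i<m. (p j $ i)\<^sup>2) = (\<Sum>j=2..l. p j \<bullet> p j)"
      using scalar_prod_lessThan[OF p, symmetric] by (intro sum.cong refl) (simp add: power2_eq_square)
    finally show ?thesis using l by (simp add: of_nat_diff)
  qed
  have Q: "u \<bullet> (G_mat l m n A H \<beta> *\<^sub>v u)
    = (\<Sum>j=1..l. R j) + \<beta> * (real l - 1) * (\<Sum>j=2..l. p j \<bullet> p j) - 2 * (s \<bullet> z) + (z \<bullet> z) / \<beta>"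
  proof -
    have split: "{1..l} = insert 1 {2..l}" using l by auto
    have xHx: "(\<Sum>j=1..l. x j \<bullet> (H j *\<^sub>v x j))
        = (\<Sum>j=1..l. R j) + \<beta> * (real l - 2) * (\<Sum>j=2..l. p j \<bullet> p j)"
      unfolding split by (simp add: R_def p_def sum_subtractf sum_distrib_left)
    have cross: "(\<Sum>j=2..l. \<beta> * (p j \<bullet> p j) - p j \<bullet> z - p j \<bullet> z)
        = \<beta> * (\<Sum>j=2..l. p j \<bullet> p j) - 2 * (s \<bullet> z)"
      by (simp add: sz sum_subtractf sum_distrib_left)
    have "u \<bullet> (G_mat l m n A H \<beta> *\<^sub>v u) = (\<Sum>j=1..l. x j \<bullet> (H j *\<^sub>v x j))
        + (\<Sum>j=2..l. \<beta> * (p j \<bullet> p j) - p j \<bullet> z - p j \<bullet> z) + (z \<bullet> z) / \<beta>"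
      unfolding ux p_def G_bilinear_def[symmetric] by (rule point_G_mat[OF x z x z])
    then show ?thesis unfolding xHx cross by (simp add: algebra_simps)
  qed
  show "0 < u \<bullet> (G_mat l m n A H \<beta> *\<^sub>v u)"
  proof (cases "\<forall>j\<in>{1..l}. x j = 0\<^sub>v (n j)")
    case True
    have p0: "p j = 0\<^sub>v m" if "j \<in> {2..l}" for j
      using A[of j] True that by (auto simp: p_def)
    have "z \<noteq> 0\<^sub>v m"
    proof
      assume z0: "z = 0\<^sub>v m"
      have "u \<bullet> u = 0" unfolding ux using x z True z0
        by (subst point_scalar_prod) auto
      then show False using u scalar_prod_self_eq_0_iff by blast
    qed
    then have "0 < z \<bullet> z" using scalar_prod_self_nonneg[of z] scalar_prod_self_eq_0_iff[OF z] by linarith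
    moreover have "(\<Sum>j=1..l. R j) = 0" using True R(2) by (intro sum.neutral) auto
    moreover have "(\<Sum>j=2..l. p j \<bullet> p j) = 0" using p0 by (intro sum.neutral) auto
    moreover have "s \<bullet> z = 0" unfolding sz using p0 z by (intro sum.neutral) auto
    ultimately show ?thesis using Q \<beta> by simp
  next
    case False
    then obtain i where i: "i \<in> {1..l}" "x i \<noteq> 0\<^sub>v (n i)" by auto
    then have "0 < (\<Sum>j=1..l. R j)" using R0 R(1) by (intro sum_pos2[of _ i]) auto
    moreover have "\<beta> * (s \<bullet> s) \<le> \<beta> * ((real l - 1) * (\<Sum>j=2..l. p j \<bullet> p j))"
      using CS \<beta> by (intro mult_left_mono) auto
    moreover have "0 \<le> \<beta> * (s \<bullet> s) - 2 * (s \<bullet> z) + (z \<bullet> z) / \<beta>"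
    proof -
      have "0 \<le> (\<beta> \<cdot>\<^sub>v s - z) \<bullet> (\<beta> \<cdot>\<^sub>v s - z)" by (rule scalar_prod_self_nonneg)
      also have "\<dots> = \<beta>\<^sup>2 * (s \<bullet> s) - 2 * \<beta> * (s \<bullet> z) + z \<bullet> z"
        using s z comm_scalar_prod[OF z s]
        by (simp add: minus_scalar_prod_distrib[of _ m] scalar_prod_minus_distrib[of _ m]
            power2_eq_square algebra_simps)
      finally have "0 \<le> (\<beta>\<^sup>2 * (s \<bullet> s) - 2 * \<beta> * (s \<bullet> z) + z \<bullet> z) / \<beta>" using \<beta> by simp
      then show ?thesis using \<beta> by (simp add: field_simps power2_eq_square)
    qed
    ultimately show ?thesis unfolding Q by (simp add: algebra_simps)
  qed
qed

end

section \<open>Optimality of one block step\<close>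

text \<open>
  First-order optimality without subgradients. Moving from \<open>p\<close> towards \<open>v\<close> by a fraction \<open>t\<close>
  changes the convex part by at most \<open>t (f v - f p)\<close> and the quadratic part by
  \<open>t a + t\<^sup>2 b\<close>; dividing by \<open>t\<close> and letting \<open>t\<close> tend to zero gives the claim.
\<close>

lemma convex_plus_quadratic_minimizer:
  assumes X: "convex_vec_set n X" and f: "convex_vec_fun n f" and p: "p \<in> X" and v: "v \<in> X"
    and min: "\<And>u. u \<in> X \<Longrightarrow> f p + q p \<le> f u + q u"
    and q: "\<And>t. q ((1 - t) \<cdot>\<^sub>v p + t \<cdot>\<^sub>v v) = q p + t * a + t\<^sup>2 * b"
  shows "0 \<le> f v - f p + a"
proof -
  have pv: "p \<in> carrier_vec n" "v \<in> carrier_vec n" using X p v by (auto simp: convex_vec_set_def)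
  have "- (f v - f p + a) \<le> t * b" if t: "0 < t" "t \<le> 1" for t
  proof -
    let ?u = "(1 - t) \<cdot>\<^sub>v p + t \<cdot>\<^sub>v v"
    have "?u \<in> X" using X p v t by (auto simp: convex_vec_set_def)
    then have "f p + q p \<le> f ?u + q ?u" by (rule min)
    also have "f ?u \<le> (1 - t) * f p + t * f v" using f pv t by (auto simp: convex_vec_fun_def)
    finally have "0 \<le> t * (f v - f p + a + t * b)"
      unfolding q by (simp add: algebra_simps power2_eq_square)
    then show ?thesis using t by (simp add: zero_le_mult_iff)
  qed
  then have "\<forall>\<^sub>F t in at_right 0. - (f v - f p + a) \<le> t * b"
    unfolding eventually_at_right_field by (intro exI[of _ 1]) auto
  moreover have "((\<lambda>t. t * b) \<longlongrightarrow> 0 * b) (at_right 0)" by (intro tendsto_intros)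
  ultimately have "- (f v - f p + a) \<le> 0 * b"
    by (intro tendsto_lowerbound[where F = "at_right (0::real)"]) auto
  then show ?thesis by simp
qed

text \<open>
  If \<open>f v > r\<close>, then \<open>(v, r)\<close> lies in the open complement of the epigraph, and so do the nearby
  points \<open>(u k, r)\<close>.
\<close>

lemma closed_vec_fun_lower_semicontinuous:
  assumes f: "closed_vec_fun n f" and u: "\<And>k. u k \<in> carrier_vec n"
    and lim: "limitin (vec_topology n) u v sequentially" and \<epsilon>: "\<epsilon> > 0"
  shows "\<forall>\<^sub>F k in sequentially. f v - \<epsilon> < f (u k)"
proof -
  let ?T = "prod_topology (vec_topology n) euclideanreal"
  let ?E = "{(x, r). x \<in> carrier_vec n \<and> f x \<le> r}"
  have v: "v \<in> carrier_vec n" using lim by (rule limitin_vec_carrier)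
  have op: "openin ?T (topspace ?T - ?E)" using f unfolding closed_vec_fun_def closedin_def by blast
  have "limitin ?T (\<lambda>k. (u k, f v - \<epsilon>)) (v, f v - \<epsilon>) sequentially"
    using lim by (simp add: limitin_pairwise o_def)
  then have "\<forall>\<^sub>F k in sequentially. (u k, f v - \<epsilon>) \<in> topspace ?T - ?E"
    using op v \<epsilon> unfolding limitin_def by auto
  then show ?thesis by eventually_elim (use u in auto)
qed

lemma closed_vec_fun_sum_le_limit:
  fixes f :: "nat \<Rightarrow> real vec \<Rightarrow> real"
  assumes f: "\<And>j. j \<in> {1..l} \<Longrightarrow> closed_vec_fun (n j) (f j)"
    and x: "\<And>k j. j \<in> {1..l} \<Longrightarrow> x k j \<in> carrier_vec (n j)"
    and lim: "\<And>j. j \<in> {1..l} \<Longrightarrow> limitin (vec_topology (n j)) (\<lambda>k. x k j) (y j) sequentially"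
    and le: "\<And>k. (\<Sum>j=1..l. f j (x k j)) \<le> \<rho> k" and \<rho>: "\<rho> \<longlonglongrightarrow> R"
  shows "(\<Sum>j=1..l. f j (y j)) \<le> R"
proof (rule field_le_epsilon)
  fix e :: real assume e: "e > 0"
  define \<epsilon> where "\<epsilon> = e / real (Suc l)"
  have \<epsilon>: "\<epsilon> > 0" using e by (simp add: \<epsilon>_def)
  have l\<epsilon>: "real l * \<epsilon> \<le> e" using e by (simp add: \<epsilon>_def divide_simps)
  have "\<forall>\<^sub>F k in sequentially. \<forall>j\<in>{1..l}. f j (y j) - \<epsilon> < f j (x k j)"
    using closed_vec_fun_lower_semicontinuous[OF f x lim \<epsilon>] by (intro eventually_ball_finite) auto
  then have "\<forall>\<^sub>F k in sequentially. (\<Sum>j=1..l. f j (y j)) - real l * \<epsilon> \<le> \<rho> k"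
  proof eventually_elim
    case (elim k)
    have "(\<Sum>j=1..l. f j (y j)) - real l * \<epsilon> = (\<Sum>j=1..l. f j (y j) - \<epsilon>)"
      by (simp add: sum_subtractf)
    also have "\<dots> \<le> (\<Sum>j=1..l. f j (x k j))" using elim by (intro sum_mono) force
    also have "\<dots> \<le> \<rho> k" by (rule le)
    finally show ?case .
  qed
  then have "(\<Sum>j=1..l. f j (y j)) - real l * \<epsilon> \<le> R"
    by (intro tendsto_lowerbound[OF \<rho>]) auto
  then show "(\<Sum>j=1..l. f j (y j)) \<le> R + e" using l\<epsilon> by linarith
qed

lemma residual_carrier:
  assumes "\<And>j. j \<in> {1..l} \<Longrightarrow> A j \<in> carrier_mat m (n j)" "c \<in> carrier_vec m"
  shows "residual l m A c x \<in> carrier_vec m"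
proof -
  have "A j *\<^sub>v x j \<in> carrier_vec m" if "j \<in> {1..l}" for j
    using assms(1)[OF that] by (intro carrier_vecI) simp
  then show ?thesis
    unfolding residual_def using assms(2) by (intro minus_carrier_vec finsum_vec_carrier)
qed

lemma residual_index:
  assumes A: "\<And>j. j \<in> {1..l} \<Longrightarrow> A j \<in> carrier_mat m (n j)" and c: "c \<in> carrier_vec m"
    and x: "\<And>j. j \<in> {1..l} \<Longrightarrow> x j \<in> carrier_vec (n j)" and i: "i < m"
  shows "residual l m A c x $ i = (\<Sum>j=1..l. (A j *\<^sub>v x j) $ i) - c $ i"
proof -
  have "(\<lambda>j. A j *\<^sub>v x j) \<in> {1..l} \<rightarrow> carrier_vec m"
    using mult_mat_vec_carrier[OF A x] by auto
  from index_finsum_vec[OF _ i this] show ?thesis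
    unfolding residual_def using c i by (subst index_minus_vec) auto
qed

lemma residual_scalar_prod:
  assumes A: "\<And>j. j \<in> {1..l} \<Longrightarrow> A j \<in> carrier_mat m (n j)" and c: "c \<in> carrier_vec m"
    and x: "\<And>j. j \<in> {1..l} \<Longrightarrow> x j \<in> carrier_vec (n j)" and z: "z \<in> carrier_vec m"
  shows "residual l m A c x \<bullet> z = (\<Sum>j=1..l. (A j *\<^sub>v x j) \<bullet> z) - c \<bullet> z"
proof -
  have Ax: "A j *\<^sub>v x j \<in> carrier_vec m" if "j \<in> {1..l}" for j
    using A[OF that] x[OF that] by (rule mult_mat_vec_carrier)
  have "residual l m A c x \<bullet> z = finsum_vec TYPE(real) m (\<lambda>j. A j *\<^sub>v x j) {1..l} \<bullet> z - c \<bullet> z"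
    unfolding residual_def using finsum_vec_carrier[OF Ax] c z by (intro minus_scalar_prod_distrib)
  also have "finsum_vec TYPE(real) m (\<lambda>j. A j *\<^sub>v x j) {1..l} \<bullet> z = (\<Sum>j=1..l. (A j *\<^sub>v x j) \<bullet> z)"
    using Ax z by (intro finsum_vec_scalar_prod) auto
  finally show ?thesis .
qed

lemma residual_fun_upd:
  assumes A: "\<And>j. j \<in> {1..l} \<Longrightarrow> A j \<in> carrier_mat m (n j)" and c: "c \<in> carrier_vec m"
    and y: "\<And>j. j \<in> {1..l} \<Longrightarrow> y j \<in> carrier_vec (n j)" and i: "i \<in> {1..l}"
    and p: "p \<in> carrier_vec (n i)" and d: "d \<in> carrier_vec (n i)"
  shows "residual l m A c (y(i := p + t \<cdot>\<^sub>v d)) = residual l m A c (y(i := p)) + t \<cdot>\<^sub>v (A i *\<^sub>v d)"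
proof (rule eq_vecI)
  have Ai: "A i \<in> carrier_mat m (n i)" using A i by blast
  fix k assume "k < dim_vec (residual l m A c (y(i := p)) + t \<cdot>\<^sub>v (A i *\<^sub>v d))"
  then have k: "k < m" using Ai by simp
  have "(A j *\<^sub>v (y(i := p + t \<cdot>\<^sub>v d)) j) $ k
      = (A j *\<^sub>v (y(i := p)) j) $ k + (if j = i then t * (A i *\<^sub>v d) $ k else 0)" for j
    using Ai p d k by (auto simp: scalar_prod_add_distrib[of _ "n i"])
  then have "(\<Sum>j=1..l. (A j *\<^sub>v (y(i := p + t \<cdot>\<^sub>v d)) j) $ k)
      = (\<Sum>j=1..l. (A j *\<^sub>v (y(i := p)) j) $ k) + t * (A i *\<^sub>v d) $ k"
    using i by (simp only: sum.distrib sum.delta finite_atLeastAtMost if_True)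
  moreover have "residual l m A c (y(i := p + t \<cdot>\<^sub>v d)) $ k
      = (\<Sum>j=1..l. (A j *\<^sub>v (y(i := p + t \<cdot>\<^sub>v d)) j) $ k) - c $ k"
    by (rule residual_index[OF A c _ k]) (use y p d in auto)
  moreover have "residual l m A c (y(i := p)) $ k = (\<Sum>j=1..l. (A j *\<^sub>v (y(i := p)) j) $ k) - c $ k"
    by (rule residual_index[OF A c _ k]) (use y p d in auto)
  moreover have "(residual l m A c (y(i := p)) + t \<cdot>\<^sub>v (A i *\<^sub>v d)) $ k
      = residual l m A c (y(i := p)) $ k + t * (A i *\<^sub>v d) $ k"
    using Ai k by simp
  ultimately show "residual l m A c (y(i := p + t \<cdot>\<^sub>v d)) $ k
      = (residual l m A c (y(i := p)) + t \<cdot>\<^sub>v (A i *\<^sub>v d)) $ k" by (simp only: )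
next
  have "dim_vec (residual l m A c u) = m" for u
    using residual_carrier[OF A c] by (rule carrier_vecD)
  then show "dim_vec (residual l m A c (y(i := p + t \<cdot>\<^sub>v d)))
      = dim_vec (residual l m A c (y(i := p)) + t \<cdot>\<^sub>v (A i *\<^sub>v d))"
    using A[OF i] by simp
qed

text \<open>
  Along the segment from \<open>p\<close> to \<open>v\<close>, everything in the block subproblem except \<open>f i\<close> is a
  quadratic polynomial in the parameter, because the residual is affine in the block.
\<close>

lemma prox_step_optimality:
  assumes A: "\<And>j. j \<in> {1..l} \<Longrightarrow> A j \<in> carrier_mat m (n j)" and c: "c \<in> carrier_vec m"
    and y: "\<And>j. j \<in> {1..l} \<Longrightarrow> y j \<in> carrier_vec (n j)" and \<zeta>: "\<zeta> \<in> carrier_vec m"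
    and i: "i \<in> {1..l}" and X: "convex_vec_set (n i) X" and f: "convex_vec_fun (n i) (f i)"
    and H: "pos_semidef (n i) H" and b: "b \<in> carrier_vec (n i)"
    and min: "is_arg_min (\<lambda>u. aug_lagrangian l m A c f \<beta> (y(i := u)) \<zeta> + 1 / 2 * quad_norm H (u - b))
      (\<lambda>u. u \<in> X) p"
    and v: "v \<in> X"
  shows "0 \<le> f i v - f i p - (A i *\<^sub>v (v - p)) \<bullet> \<zeta>
    + \<beta> * ((A i *\<^sub>v (v - p)) \<bullet> residual l m A c (y(i := p))) + (v - p) \<bullet> (H *\<^sub>v (p - b))"
proof -
  have p: "p \<in> X" using min by (simp add: is_arg_min_def)
  have pv: "p \<in> carrier_vec (n i)" "v \<in> carrier_vec (n i)"
    using X p v by (auto simp: convex_vec_set_def)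
  define d where "d = v - p"
  have d: "d \<in> carrier_vec (n i)" using pv by (simp add: d_def)
  have Ai: "A i \<in> carrier_mat m (n i)" using A i by blast
  have Ad: "A i *\<^sub>v d \<in> carrier_vec m" using Ai d by simp
  define r where "r u = residual l m A c (y(i := u))" for u
  have r: "r u \<in> carrier_vec m" for u unfolding r_def by (rule residual_carrier[OF A c])
  define q where "q u = - (\<zeta> \<bullet> r u) + \<beta> / 2 * (r u \<bullet> r u) + 1 / 2 * quad_norm H (u - b)" for u
  define C where "C = (\<Sum>j\<in>{1..l} - {i}. f j (y j))"
  have L: "aug_lagrangian l m A c f \<beta> (y(i := u)) \<zeta> + 1 / 2 * quad_norm H (u - b) = C + (f i u + q u)" for u
  proof -
    have "(\<Sum>j=1..l. f j ((y(i := u)) j)) = f i u + C"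
      unfolding C_def using i by (subst sum.remove[of _ i]) (auto intro!: sum.cong)
    then show ?thesis unfolding aug_lagrangian_def q_def r_def by simp
  qed
  define a where "a = - ((A i *\<^sub>v d) \<bullet> \<zeta>) + \<beta> * ((A i *\<^sub>v d) \<bullet> r p) + d \<bullet> (H *\<^sub>v (p - b))"
  define b2 where "b2 = \<beta> / 2 * ((A i *\<^sub>v d) \<bullet> (A i *\<^sub>v d)) + 1 / 2 * quad_norm H d"
  have "0 \<le> f i v - f i p + a"
  proof (rule convex_plus_quadratic_minimizer[OF X f p v])
    fix u assume "u \<in> X"
    then show "f i p + q p \<le> f i u + q u"
      using min unfolding is_arg_min_def L by (auto simp: not_less)
  next
    fix t
    have u: "(1 - t) \<cdot>\<^sub>v p + t \<cdot>\<^sub>v v = p + t \<cdot>\<^sub>v d"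
      using pv by (intro eq_vecI) (auto simp: d_def algebra_simps)
    have ru: "r (p + t \<cdot>\<^sub>v d) = r p + t \<cdot>\<^sub>v (A i *\<^sub>v d)"
      unfolding r_def by (rule residual_fun_upd[where n = n, OF A c y i pv(1) d])
    have 1: "\<zeta> \<bullet> r (p + t \<cdot>\<^sub>v d) = \<zeta> \<bullet> r p + t * ((A i *\<^sub>v d) \<bullet> \<zeta>)"
      unfolding ru using r[of p] Ad \<zeta> comm_scalar_prod[OF \<zeta> Ad]
      by (subst scalar_prod_add_distrib[of _ m]) auto
    have 2: "r (p + t \<cdot>\<^sub>v d) \<bullet> r (p + t \<cdot>\<^sub>v d)
        = r p \<bullet> r p + 2 * t * ((A i *\<^sub>v d) \<bullet> r p) + t\<^sup>2 * ((A i *\<^sub>v d) \<bullet> (A i *\<^sub>v d))"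
      unfolding ru using r[of p] Ad comm_scalar_prod[OF r[of p] Ad]
      by (simp add: add_scalar_prod_distrib[of _ m] scalar_prod_add_distrib[of _ m]
          algebra_simps power2_eq_square del: index_mult_mat_vec)
    have "p + t \<cdot>\<^sub>v d - b = t \<cdot>\<^sub>v d + 1 \<cdot>\<^sub>v (p - b)"
      using pv d b by (intro eq_vecI) auto
    then have 3: "quad_norm H (p + t \<cdot>\<^sub>v d - b)
        = quad_norm H (p - b) + 2 * t * (d \<bullet> (H *\<^sub>v (p - b))) + t\<^sup>2 * quad_norm H d"
      using quad_norm_lincomb[of H "n i" d "p - b" t 1] H d pv b by (simp add: pos_semidef_def)
    show "q ((1 - t) \<cdot>\<^sub>v p + t \<cdot>\<^sub>v v) = q p + t * a + t\<^sup>2 * b2"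
      unfolding u q_def 1 2 3 a_def b2_def by (simp add: algebra_simps)
  qed
  then show ?thesis by (simp add: a_def d_def r_def)
qed

section \<open>The iteration as an inertial proximal point method\<close>

text \<open>
  The linear part of the affine map \<open>F\<close> is skew, so the pairing with a difference of two points
  loses its quadratic terms and depends on each of the two points only through its residual and
  its multiplier.
\<close>

lemma VI_map_gap:
  assumes A: "\<And>j. j \<in> {1..l} \<Longrightarrow> A j \<in> carrier_mat m (n j)" and c: "c \<in> carrier_vec m"
    and v: "\<And>j. j \<in> {1..l} \<Longrightarrow> v j \<in> carrier_vec (n j)" and \<zeta>: "\<zeta> \<in> carrier_vec m"
    and x: "\<And>j. j \<in> {1..l} \<Longrightarrow> x j \<in> carrier_vec (n j)" and z: "z \<in> carrier_vec m"
  shows "(point l m n v \<zeta> - point l m n x z) \<bullet> VI_map l m n A c x z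
    = residual l m A c x \<bullet> \<zeta> - residual l m A c v \<bullet> z"
proof -
  have r: "residual l m A c x \<in> carrier_vec m" by (rule residual_carrier[OF A c])
  have diff: "point l m n v \<zeta> - point l m n x z = point l m n (\<lambda>j. v j - x j) (\<zeta> - z)"
    by (rule point_minus[OF x z])
  have "(point l m n v \<zeta> - point l m n x z) \<bullet> VI_map l m n A c x z
      = (\<Sum>j=1..l. (v j - x j) \<bullet> (- (transpose_mat (A j) *\<^sub>v z))) + (\<zeta> - z) \<bullet> residual l m A c x"
    unfolding VI_map_def diff
  proof (rule point_scalar_prod)
    show "- (transpose_mat (A j) *\<^sub>v z) \<in> carrier_vec (n j)" if "j \<in> {1..l}" for j
      using A[OF that] z by auto
  qed (rule r)
  also have "(\<Sum>j=1..l. (v j - x j) \<bullet> (- (transpose_mat (A j) *\<^sub>v z)))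
      = (\<Sum>j=1..l. (A j *\<^sub>v x j) \<bullet> z - (A j *\<^sub>v v j) \<bullet> z)"
  proof (rule sum.cong)
    fix j assume j: "j \<in> {1..l}"
    note Aj = A[OF j] and vj = v[OF j] and xj = x[OF j]
    have d: "v j - x j \<in> carrier_vec (n j)" using vj xj by simp
    have "(v j - x j) \<bullet> (- (transpose_mat (A j) *\<^sub>v z)) = - ((A j *\<^sub>v (v j - x j)) \<bullet> z)"
      using mult_mat_vec_scalar_prod[OF Aj d z] d Aj xj by (subst scalar_prod_uminus_right) auto
    also have "A j *\<^sub>v (v j - x j) = A j *\<^sub>v v j - A j *\<^sub>v x j"
      using Aj vj xj by (rule mult_minus_distrib_mat_vec)
    also have "(A j *\<^sub>v v j - A j *\<^sub>v x j) \<bullet> z = (A j *\<^sub>v v j) \<bullet> z - (A j *\<^sub>v x j) \<bullet> z"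
      using Aj vj xj z by (intro minus_scalar_prod_distrib[of _ m]) auto
    finally show "(v j - x j) \<bullet> (- (transpose_mat (A j) *\<^sub>v z)) = (A j *\<^sub>v x j) \<bullet> z - (A j *\<^sub>v v j) \<bullet> z"
      by simp
  qed simp
  also have "\<dots> = residual l m A c x \<bullet> z - residual l m A c v \<bullet> z"
  proof -
    have "residual l m A c x \<bullet> z = (\<Sum>j=1..l. (A j *\<^sub>v x j) \<bullet> z) - c \<bullet> z"
      by (rule residual_scalar_prod[OF A c x z])
    moreover have "residual l m A c v \<bullet> z = (\<Sum>j=1..l. (A j *\<^sub>v v j) \<bullet> z) - c \<bullet> z"
      by (rule residual_scalar_prod[OF A c v z])
    ultimately show ?thesis by (simp add: sum_subtractf)
  qed
  also have "(\<zeta> - z) \<bullet> residual l m A c x = residual l m A c x \<bullet> \<zeta> - residual l m A c x \<bullet> z"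
    using minus_scalar_prod_distrib[OF \<zeta> z r] comm_scalar_prod[OF \<zeta> r] comm_scalar_prod[OF z r] by simp
  finally show ?thesis by simp
qed

text \<open>
  For \<open>L(v, \<zeta>) = \<theta>(v) - \<langle>\<zeta>, r(v)\<rangle>\<close>, where \<open>\<theta>\<close> is the objective and \<open>r\<close> the residual, the
  inequality reads \<open>L(xs, \<zeta>) \<le> L(v, zs)\<close>, the saddle point property of the ordinary Lagrangian.
\<close>

definition saddle_point :: "nat \<Rightarrow> nat \<Rightarrow> (nat \<Rightarrow> real mat) \<Rightarrow> real vec \<Rightarrow> (nat \<Rightarrow> real vec set)
    \<Rightarrow> (nat \<Rightarrow> real vec \<Rightarrow> real) \<Rightarrow> (nat \<Rightarrow> real vec) \<Rightarrow> real vec \<Rightarrow> bool" where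
  "saddle_point l m A c X f xs zs \<longleftrightarrow> feasible_blocks l m X xs zs \<and>
     (\<forall>v \<zeta>. feasible_blocks l m X v \<zeta> \<longrightarrow>
       0 \<le> (\<Sum>j=1..l. f j (v j)) - (\<Sum>j=1..l. f j (xs j))
         + (residual l m A c xs \<bullet> \<zeta> - residual l m A c v \<bullet> zs))"

context
  fixes l m :: nat and n :: "nat \<Rightarrow> nat" and A H :: "nat \<Rightarrow> real mat" and c :: "real vec"
    and X :: "nat \<Rightarrow> real vec set" and f :: "nat \<Rightarrow> real vec \<Rightarrow> real" and \<beta> :: real
  assumes l: "l \<ge> 2"
    and A: "\<And>j. j \<in> {1..l} \<Longrightarrow> A j \<in> carrier_mat m (n j)"
    and c: "c \<in> carrier_vec m"
    and X: "\<And>j. j \<in> {1..l} \<Longrightarrow> convex_vec_set (n j) (X j)"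
    and f: "\<And>j. j \<in> {1..l} \<Longrightarrow> convex_vec_fun (n j) (f j)"
    and H: "\<And>j. j \<in> {1..l} \<Longrightarrow> pos_semidef (n j) (H j)"
    and \<beta>: "\<beta> > 0"
begin

lemma X_carrier: "j \<in> {1..l} \<Longrightarrow> v \<in> X j \<Longrightarrow> v \<in> carrier_vec (n j)"
  using X by (auto simp: convex_vec_set_def)

lemma res_carrier: "residual l m A c u \<in> carrier_vec m"
  by (rule residual_carrier[OF A c])

lemma feasible_carrier:
  assumes "feasible_blocks l m X v \<zeta>"
  shows "j \<in> {1..l} \<Longrightarrow> v j \<in> carrier_vec (n j)" "\<zeta> \<in> carrier_vec m"
  using assms X_carrier by (auto simp: feasible_blocks_def)

lemma kkt_points_eq_saddle_points: "kkt_points l m n A c X f = {point l m n xs zs | xs zs. saddle_point l m A c X f xs zs}"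
proof -
  have gap: "(point l m n v \<zeta> - point l m n xs zs) \<bullet> VI_map l m n A c xs zs
      = residual l m A c xs \<bullet> \<zeta> - residual l m A c v \<bullet> zs"
    if "feasible_blocks l m X xs zs" "feasible_blocks l m X v \<zeta>" for xs zs v \<zeta>
    by (rule VI_map_gap[OF A c feasible_carrier[OF that(2)] feasible_carrier[OF that(1)]])
  have "(feasible_blocks l m X xs zs \<and> (\<forall>v \<zeta>. feasible_blocks l m X v \<zeta> \<longrightarrow>
      (\<Sum>j=1..l. f j (v j)) - (\<Sum>j=1..l. f j (xs j))
        + (point l m n v \<zeta> - point l m n xs zs) \<bullet> VI_map l m n A c xs zs \<ge> 0)) \<longleftrightarrow> saddle_point l m A c X f xs zs" for xs zs
    unfolding saddle_point_def by (cases "feasible_blocks l m X xs zs") (simp_all add: gap)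
  then show ?thesis unfolding kkt_points_def by (simp only:)
qed

text \<open>
  Testing the saddle point with its own primal part and the multiplier \<open>zs - r\<close>, where \<open>r\<close> is
  the residual, gives \<open>0 \<le> - \<parallel>r\<parallel>\<^sup>2\<close>.
\<close>

lemma saddle_point_residual:
  assumes "saddle_point l m A c X f xs zs"
  shows "residual l m A c xs = 0\<^sub>v m"
proof -
  define r where "r = residual l m A c xs"
  have r: "r \<in> carrier_vec m" unfolding r_def by (rule residual_carrier[OF A c])
  have fe: "feasible_blocks l m X xs zs" using assms by (simp add: saddle_point_def)
  then have zs: "zs \<in> carrier_vec m" by (rule feasible_carrier)
  have "feasible_blocks l m X xs (zs - r)" using fe r by (simp add: feasible_blocks_def)
  then have "0 \<le> r \<bullet> (zs - r) - r \<bullet> zs"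
    using assms unfolding saddle_point_def r_def by fastforce
  also have "\<dots> = - (r \<bullet> r)" using r zs by (subst scalar_prod_minus_distrib[of _ m]) auto
  finally have "r \<bullet> r = 0" using scalar_prod_self_nonneg[of r] by linarith
  then show ?thesis using scalar_prod_self_eq_0_iff[OF r] by (simp add: r_def)
qed

context
  fixes \<alpha> :: "nat \<Rightarrow> real" and x :: "nat \<Rightarrow> nat \<Rightarrow> real vec" and z :: "nat \<Rightarrow> real vec"
  assumes iter: "prox_iadmm l m A c X f H \<beta> \<alpha> x z"
begin

abbreviation (input) xbar where "xbar k \<equiv> (\<lambda>j. extrapolate \<alpha> (\<lambda>k. x k j) k)"
abbreviation (input) zbar where "zbar k \<equiv> extrapolate \<alpha> z k"
abbreviation (input) iterate where "iterate k \<equiv> point l m n (x k) (z k)"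

lemma first_block_step:
  "is_arg_min (\<lambda>u. aug_lagrangian l m A c f \<beta> ((xbar k)(1 := u)) (zbar k)
      + 1 / 2 * quad_norm (H 1) (u - xbar k 1)) (\<lambda>u. u \<in> X 1) (x (Suc k) 1)"
  using iter unfolding prox_iadmm_def Let_def by blast

lemma multiplier_step:
  "z (Suc k) = zbar k - \<beta> \<cdot>\<^sub>v residual l m A c ((xbar k)(1 := x (Suc k) 1))"
  using iter unfolding prox_iadmm_def Let_def by blast

lemma later_block_step:
  "i \<in> {2..l} \<Longrightarrow> is_arg_min (\<lambda>u. aug_lagrangian l m A c f \<beta>
      ((xbar k)(1 := x (Suc k) 1, i := u)) (z (Suc k))
      + 1 / 2 * quad_norm (H i) (u - xbar k i)) (\<lambda>u. u \<in> X i) (x (Suc k) i)"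
  using iter unfolding prox_iadmm_def Let_def by blast

lemma iterate_feasible: "feasible_blocks l m X (x k) (z k)"
proof (cases k)
  case 0
  then show ?thesis using iter by (simp add: prox_iadmm_def)
next
  case (Suc i)
  have "x k j \<in> X j" if "j \<in> {1..l}" for j
    using that first_block_step[of i] later_block_step[of j i] Suc
    by (cases "j = 1") (auto simp: is_arg_min_def)
  moreover have "z k \<in> carrier_vec m"
    using res_carrier[THEN carrier_vecD] unfolding Suc multiplier_step
    by (intro carrier_vecI) simp
  ultimately show ?thesis by (simp add: feasible_blocks_def)
qed

lemmas iterate_carrier = feasible_carrier[OF iterate_feasible]

lemma xbar_carrier: "j \<in> {1..l} \<Longrightarrow> xbar k j \<in> carrier_vec (n j)"
  by (rule extrapolate_carrier) (rule iterate_carrier)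

lemma zbar_carrier: "zbar k \<in> carrier_vec m"
  by (rule extrapolate_carrier) (rule iterate_carrier)

text \<open>
  One sweep of the method is one proximal step in the metric of the block matrix. The multiplier
  update turns the residual \<open>r\<close> seen by the first block into \<open>- ez / \<beta>\<close>. Hence the first
  subproblem is optimal for the new multiplier, while the later blocks, which keep the
  extrapolated values of each other, carry the extra terms \<open>T j\<close>. The sum of these optimality
  conditions is the stated inequality: the remaining entries of the block matrix encode that the
  residual \<open>R\<close> of the new iterate is \<open>\<Sum> A j e j - ez / \<beta>\<close>, the sum over the later blocks.
\<close>

lemma proximal_variational_inequality:
  assumes fe: "feasible_blocks l m X v \<zeta>"
  shows "0 \<le> (\<Sum>j=1..l. f j (v j)) - (\<Sum>j=1..l. f j (x (Suc k) j))
    + (residual l m A c (x (Suc k)) \<bullet> \<zeta> - residual l m A c v \<bullet> z (Suc k))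
    + (point l m n v \<zeta> - iterate (Suc k)) \<bullet>
        (G_mat l m n A H \<beta> *\<^sub>v (iterate (Suc k) - extrapolate \<alpha> iterate k))"
proof -
  note vc = feasible_carrier[OF fe]
  note xc = iterate_carrier(1)[of _ "Suc k"] and zc = iterate_carrier(2)[of "Suc k"]
  define d where "d j = v j - x (Suc k) j" for j
  define e where "e j = x (Suc k) j - xbar k j" for j
  define dz where "dz = \<zeta> - z (Suc k)"
  define ez where "ez = z (Suc k) - zbar k"
  define y where "y = (xbar k)(1 := x (Suc k) 1)"
  define r where "r = residual l m A c y"
  define R where "R = residual l m A c (x (Suc k))"
  have dc: "d j \<in> carrier_vec (n j)" if "j \<in> {1..l}" for j
    using vc(1)[OF that] xc[OF that] by (simp add: d_def)
  have ec: "e j \<in> carrier_vec (n j)" if "j \<in> {1..l}" for j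
    using xbar_carrier[OF that] xc[OF that] by (simp add: e_def)
  have dzc: "dz \<in> carrier_vec m" and ezc: "ez \<in> carrier_vec m"
    using vc(2) zc zbar_carrier by (simp_all add: dz_def ez_def)
  have yc: "y j \<in> carrier_vec (n j)" if "j \<in> {1..l}" for j
    using xbar_carrier[OF that, of k] xc[OF that] by (cases "j = 1") (simp_all add: y_def)
  have rc: "r \<in> carrier_vec m" and Rc: "R \<in> carrier_vec m"
    unfolding r_def R_def by (rule res_carrier)+
  have zp: "\<xi> \<bullet> z (Suc k) = \<xi> \<bullet> zbar k - \<beta> * (\<xi> \<bullet> r)" and ep: "\<xi> \<bullet> ez = - \<beta> * (\<xi> \<bullet> r)"
    if "\<xi> \<in> carrier_vec m" for \<xi>
  proof -
    have "\<xi> \<bullet> z (Suc k) = \<xi> \<bullet> (zbar k - \<beta> \<cdot>\<^sub>v r)"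
      unfolding multiplier_step[of k] y_def r_def by (rule refl)
    also have "\<dots> = \<xi> \<bullet> zbar k - \<beta> * (\<xi> \<bullet> r)"
      using that zbar_carrier[of k] rc by (subst scalar_prod_minus_distrib[of _ m]) auto
    finally show zp: "\<xi> \<bullet> z (Suc k) = \<xi> \<bullet> zbar k - \<beta> * (\<xi> \<bullet> r)" .
    have "\<xi> \<bullet> ez = \<xi> \<bullet> z (Suc k) - \<xi> \<bullet> zbar k"
      unfolding ez_def by (rule scalar_prod_minus_distrib[OF that zc zbar_carrier])
    then show "\<xi> \<bullet> ez = - \<beta> * (\<xi> \<bullet> r)" using zp by simp
  qed
  define T where "T j = \<beta> * ((A j *\<^sub>v d j) \<bullet> (A j *\<^sub>v e j)) - (A j *\<^sub>v d j) \<bullet> ez" for j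
  have one: "1 \<in> {1..l}" using l by auto
  have Adc: "A j *\<^sub>v d j \<in> carrier_vec m" "A j *\<^sub>v e j \<in> carrier_vec m" if "j \<in> {1..l}" for j
    by (rule mult_mat_vec_carrier[OF A[OF that] dc[OF that]] mult_mat_vec_carrier[OF A[OF that] ec[OF that]])+
  \<comment> \<open>Optimality of the blocks, all expressed through the new multiplier.\<close>
  have block: "0 \<le> f j (v j) - f j (x (Suc k) j) - (A j *\<^sub>v d j) \<bullet> z (Suc k) + d j \<bullet> (H j *\<^sub>v e j)
      + (if j = 1 then 0 else T j)" if j: "j \<in> {1..l}" for j
  proof (cases "j = 1")
    case True
    have "0 \<le> f 1 (v 1) - f 1 (x (Suc k) 1) - (A 1 *\<^sub>v (v 1 - x (Suc k) 1)) \<bullet> zbar k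
      + \<beta> * ((A 1 *\<^sub>v (v 1 - x (Suc k) 1)) \<bullet> residual l m A c ((xbar k)(1 := x (Suc k) 1)))
      + (v 1 - x (Suc k) 1) \<bullet> (H 1 *\<^sub>v (x (Suc k) 1 - xbar k 1))"
    proof (rule prox_step_optimality[where n = n and f = f and X = "X 1" and \<beta> = \<beta>,
        OF A c _ zbar_carrier one X[OF one] f[OF one] H[OF one] _ first_block_step])
      show "v 1 \<in> X 1" using fe one unfolding feasible_blocks_def by blast
    qed (use one xbar_carrier in auto)
    then show ?thesis
      using zp[OF Adc(1)[OF one]] unfolding True d_def e_def r_def y_def by simp
  next
    case False
    then have j2: "j \<in> {2..l}" using j by auto
    have "0 \<le> f j (v j) - f j (x (Suc k) j) - (A j *\<^sub>v (v j - x (Suc k) j)) \<bullet> z (Suc k)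
      + \<beta> * ((A j *\<^sub>v (v j - x (Suc k) j)) \<bullet> residual l m A c (y(j := x (Suc k) j)))
      + (v j - x (Suc k) j) \<bullet> (H j *\<^sub>v (x (Suc k) j - xbar k j))"
    proof (rule prox_step_optimality[where n = n and f = f and X = "X j" and \<beta> = \<beta>,
        OF A c yc zc j X[OF j] f[OF j] H[OF j]])
      show "is_arg_min (\<lambda>u. aug_lagrangian l m A c f \<beta> (y(j := u)) (z (Suc k))
          + 1 / 2 * quad_norm (H j) (u - xbar k j)) (\<lambda>u. u \<in> X j) (x (Suc k) j)"
        unfolding y_def by (rule later_block_step[OF j2])
      show "v j \<in> X j" using fe j unfolding feasible_blocks_def by blast
    qed (use j xbar_carrier in auto)
    moreover have "residual l m A c (y(j := x (Suc k) j)) = r + 1 \<cdot>\<^sub>v (A j *\<^sub>v e j)"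
    proof -
      have "x (Suc k) j = xbar k j + 1 \<cdot>\<^sub>v e j"
        using xc[OF j] xbar_carrier[OF j, of k] by (intro eq_vecI) (auto simp: e_def)
      moreover have upd: "residual l m A c (y(j := xbar k j + 1 \<cdot>\<^sub>v e j))
          = residual l m A c (y(j := xbar k j)) + 1 \<cdot>\<^sub>v (A j *\<^sub>v e j)"
        by (rule residual_fun_upd[where n = n, OF A c yc j xbar_carrier[OF j, of k] ec[OF j]])
      moreover have "y(j := xbar k j) = y" using False by (auto simp: y_def)
      ultimately show ?thesis
        using upd unfolding r_def by simp
    qed
    moreover have "(A j *\<^sub>v d j) \<bullet> (r + 1 \<cdot>\<^sub>v (A j *\<^sub>v e j))
        = (A j *\<^sub>v d j) \<bullet> r + (A j *\<^sub>v d j) \<bullet> (A j *\<^sub>v e j)"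
      using scalar_prod_add_distrib[OF Adc(1)[OF j] rc Adc(2)[OF j]] by simp
    ultimately show ?thesis
      using False ep[OF Adc(1)[OF j]] unfolding d_def[symmetric] e_def[symmetric] T_def
      by (simp add: algebra_simps)
  qed
  have split: "{1..l} = insert 1 {2..l}" using l by auto
  have "0 \<le> (\<Sum>j=1..l. f j (v j) - f j (x (Suc k) j) - (A j *\<^sub>v d j) \<bullet> z (Suc k) + d j \<bullet> (H j *\<^sub>v e j)
      + (if j = 1 then 0 else T j))"
    by (rule sum_nonneg) (rule block)
  also have "\<dots> = (\<Sum>j=1..l. f j (v j)) - (\<Sum>j=1..l. f j (x (Suc k) j)) - (\<Sum>j=1..l. (A j *\<^sub>v d j) \<bullet> z (Suc k))
      + (\<Sum>j=1..l. d j \<bullet> (H j *\<^sub>v e j)) + (\<Sum>j=1..l. if j = 1 then 0 else T j)"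
    by (simp only: sum.distrib sum_subtractf)
  also have "(\<Sum>j=1..l. if j = 1 then 0 else T j) = (\<Sum>j=2..l. T j)"
    unfolding split by (subst sum.insert) (auto intro: sum.cong)
  also have "(\<Sum>j=1..l. (A j *\<^sub>v d j) \<bullet> z (Suc k)) = residual l m A c v \<bullet> z (Suc k) - R \<bullet> z (Suc k)"
  proof -
    have "(A j *\<^sub>v d j) \<bullet> z (Suc k) = (A j *\<^sub>v v j) \<bullet> z (Suc k) - (A j *\<^sub>v x (Suc k) j) \<bullet> z (Suc k)"
      if j: "j \<in> {1..l}" for j
      unfolding d_def mult_minus_distrib_mat_vec[OF A[OF j] vc(1)[OF j] xc[OF j]]
      by (rule minus_scalar_prod_distrib[OF mult_mat_vec_carrier[OF A[OF j] vc(1)[OF j]]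
            mult_mat_vec_carrier[OF A[OF j] xc[OF j]] zc])
    then have "(\<Sum>j=1..l. (A j *\<^sub>v d j) \<bullet> z (Suc k))
        = (\<Sum>j=1..l. (A j *\<^sub>v v j) \<bullet> z (Suc k) - (A j *\<^sub>v x (Suc k) j) \<bullet> z (Suc k))"
      by (intro sum.cong refl)
    moreover have "residual l m A c v \<bullet> z (Suc k) = (\<Sum>j=1..l. (A j *\<^sub>v v j) \<bullet> z (Suc k)) - c \<bullet> z (Suc k)"
      by (rule residual_scalar_prod[OF A c vc(1) zc])
    moreover have "R \<bullet> z (Suc k) = (\<Sum>j=1..l. (A j *\<^sub>v x (Suc k) j) \<bullet> z (Suc k)) - c \<bullet> z (Suc k)"
      unfolding R_def by (rule residual_scalar_prod[OF A c xc zc])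
    ultimately show ?thesis by (simp add: sum_subtractf)
  qed
  finally have total: "0 \<le> (\<Sum>j=1..l. f j (v j)) - (\<Sum>j=1..l. f j (x (Suc k) j))
      - (residual l m A c v \<bullet> z (Suc k) - R \<bullet> z (Suc k)) + (\<Sum>j=1..l. d j \<bullet> (H j *\<^sub>v e j)) + (\<Sum>j=2..l. T j)" .
  \<comment> \<open>The multiplier row of the block matrix applied to the increment cancels the new residual.\<close>
  have Rdz: "R \<bullet> dz = (\<Sum>j=2..l. (A j *\<^sub>v e j) \<bullet> dz) - (dz \<bullet> ez) / \<beta>"
  proof -
    have "(A j *\<^sub>v x (Suc k) j) \<bullet> dz - (A j *\<^sub>v y j) \<bullet> dz = (if j = 1 then 0 else (A j *\<^sub>v e j) \<bullet> dz)"
      if j: "j \<in> {1..l}" for j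
    proof (cases "j = 1")
      case False
      have "(A j *\<^sub>v x (Suc k) j) \<bullet> dz - (A j *\<^sub>v xbar k j) \<bullet> dz = (A j *\<^sub>v e j) \<bullet> dz"
        unfolding e_def mult_minus_distrib_mat_vec[OF A[OF j] xc[OF j] xbar_carrier[OF j]]
        by (rule minus_scalar_prod_distrib[OF mult_mat_vec_carrier[OF A[OF j] xc[OF j]]
              mult_mat_vec_carrier[OF A[OF j] xbar_carrier[OF j]] dzc, symmetric])
      then show ?thesis using False by (simp add: y_def)
    qed (simp add: y_def)
    then have "(\<Sum>j=1..l. (A j *\<^sub>v x (Suc k) j) \<bullet> dz - (A j *\<^sub>v y j) \<bullet> dz)
        = (\<Sum>j=1..l. if j = 1 then 0 else (A j *\<^sub>v e j) \<bullet> dz)"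
      by (intro sum.cong refl)
    also have "\<dots> = (\<Sum>j=2..l. (A j *\<^sub>v e j) \<bullet> dz)"
      unfolding split by (subst sum.insert) (auto intro: sum.cong)
    finally have diff_sum: "(\<Sum>j=1..l. (A j *\<^sub>v x (Suc k) j) \<bullet> dz - (A j *\<^sub>v y j) \<bullet> dz)
        = (\<Sum>j=2..l. (A j *\<^sub>v e j) \<bullet> dz)" .
    have "R \<bullet> dz - r \<bullet> dz = (\<Sum>j=2..l. (A j *\<^sub>v e j) \<bullet> dz)"
    proof -
      have "R \<bullet> dz = (\<Sum>j=1..l. (A j *\<^sub>v x (Suc k) j) \<bullet> dz) - c \<bullet> dz"
        unfolding R_def by (rule residual_scalar_prod[OF A c xc dzc])
      moreover have "r \<bullet> dz = (\<Sum>j=1..l. (A j *\<^sub>v y j) \<bullet> dz) - c \<bullet> dz"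
        unfolding r_def by (rule residual_scalar_prod[OF A c yc dzc])
      ultimately show ?thesis using diff_sum by (simp add: sum_subtractf)
    qed
    moreover have "r \<bullet> dz = - ((dz \<bullet> ez) / \<beta>)"
      using ep[OF dzc] \<beta> comm_scalar_prod[OF dzc rc] by simp
    ultimately show ?thesis by simp
  qed
  have Rz: "R \<bullet> dz = R \<bullet> \<zeta> - R \<bullet> z (Suc k)"
    unfolding dz_def by (rule scalar_prod_minus_distrib[OF Rc vc(2) zc])
  have diff_v: "point l m n v \<zeta> - iterate (Suc k) = point l m n d dz"
    unfolding d_def dz_def by (rule point_minus[OF xc zc])
  have ext: "extrapolate \<alpha> iterate k = point l m n (xbar k) (zbar k)"
    by (rule extrapolate_point[OF iterate_carrier])
  have diff_e: "iterate (Suc k) - extrapolate \<alpha> iterate k = point l m n e ez"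
    unfolding e_def ez_def ext by (rule point_minus[OF xbar_carrier zbar_carrier])
  have "(point l m n v \<zeta> - iterate (Suc k)) \<bullet>
        (G_mat l m n A H \<beta> *\<^sub>v (iterate (Suc k) - extrapolate \<alpha> iterate k))
      = point l m n d dz \<bullet> (G_mat l m n A H \<beta> *\<^sub>v point l m n e ez)"
    unfolding diff_v diff_e by (rule refl)
  also have "\<dots> = G_bilinear l A H \<beta> d dz e ez"
    by (rule point_G_mat[OF l A H \<beta> dc dzc ec ezc])
  also have "\<dots> = (\<Sum>j=1..l. d j \<bullet> (H j *\<^sub>v e j)) + (\<Sum>j=2..l. T j) - (\<Sum>j=2..l. (A j *\<^sub>v e j) \<bullet> dz)
      + (dz \<bullet> ez) / \<beta>"
    unfolding G_bilinear_def T_def by (simp add: sum_subtractf)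
  finally show ?thesis using total Rdz Rz unfolding R_def by linarith
qed

end

end

section \<open>Convergence\<close>

lemma limitin_residual:
  assumes A: "\<And>j. j \<in> {1..l} \<Longrightarrow> A j \<in> carrier_mat m (n j)" and c: "c \<in> carrier_vec m"
    and x: "\<And>k j. j \<in> {1..l} \<Longrightarrow> x k j \<in> carrier_vec (n j)"
    and lim: "\<And>j. j \<in> {1..l} \<Longrightarrow> limitin (vec_topology (n j)) (\<lambda>k. x k j) (y j) sequentially"
  shows "limitin (vec_topology m) (\<lambda>k. residual l m A c (x k)) (residual l m A c y) sequentially"
proof -
  have y: "y j \<in> carrier_vec (n j)" if "j \<in> {1..l}" for j
    using lim[OF that] by (rule limitin_vec_carrier)
  have r: "residual l m A c u \<in> carrier_vec m" for u by (rule residual_carrier[OF A c])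
  have "(\<lambda>k. residual l m A c (x k) $ i) \<longlonglongrightarrow> residual l m A c y $ i" if i: "i < m" for i
  proof -
    have Ax: "(\<lambda>k. (A j *\<^sub>v x k j) $ i) \<longlonglongrightarrow> (A j *\<^sub>v y j) $ i" if j: "j \<in> {1..l}" for j
    proof -
      have "limitin (vec_topology m) (\<lambda>k. A j *\<^sub>v x k j) (A j *\<^sub>v y j) sequentially"
        using A[OF j] x[OF j] lim[OF j] by (rule limitin_mult_mat_vec)
      then show ?thesis
        using mult_mat_vec_carrier[OF A[OF j] x[OF j]] i by (rule limitin_vec_index)
    qed
    have "(\<lambda>k. (\<Sum>j=1..l. (A j *\<^sub>v x k j) $ i) - c $ i) \<longlonglongrightarrow> (\<Sum>j=1..l. (A j *\<^sub>v y j) $ i) - c $ i"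
      by (intro tendsto_intros Ax)
    moreover have "residual l m A c (x k) $ i = (\<Sum>j=1..l. (A j *\<^sub>v x k j) $ i) - c $ i" for k
      by (rule residual_index[OF A c x i])
    moreover have "residual l m A c y $ i = (\<Sum>j=1..l. (A j *\<^sub>v y j) $ i) - c $ i"
      by (rule residual_index[OF A c y i])
    ultimately show ?thesis by simp
  qed
  then show ?thesis using r by (subst limitin_vec_iff) auto
qed

theorem theorem3p3:
  fixes l m :: nat and n :: "nat \<Rightarrow> nat"
    and A H :: "nat \<Rightarrow> real mat" and c :: "real vec"
    and X :: "nat \<Rightarrow> real vec set" and f :: "nat \<Rightarrow> real vec \<Rightarrow> real"
    and \<beta> :: real and \<alpha> :: "nat \<Rightarrow> real"
    and x :: "nat \<Rightarrow> nat \<Rightarrow> real vec" and z w :: "nat \<Rightarrow> real vec"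
  assumes "l \<ge> 2"
    and "\<And>j. j \<in> {1..l} \<Longrightarrow> A j \<in> carrier_mat m (n j)"
    and "c \<in> carrier_vec m"
    and "\<And>j. j \<in> {1..l} \<Longrightarrow> closedin (vec_topology (n j)) (X j)"
    and "\<And>j. j \<in> {1..l} \<Longrightarrow> convex_vec_set (n j) (X j)"
    and "\<And>j. j \<in> {1..l} \<Longrightarrow> closed_vec_fun (n j) (f j)"
    and "\<And>j. j \<in> {1..l} \<Longrightarrow> convex_vec_fun (n j) (f j)"
    and "\<And>j. j \<in> {1..l} \<Longrightarrow> pos_semidef (n j) (H j)"
    and "\<beta> > 0"
    and "prox_iadmm l m A c X f H \<beta> \<alpha> x z"
    and "\<And>k. w k = point l m n (x k) (z k)"
    and "kkt_points l m n A c X f \<noteq> {}"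
    and "\<exists>\<alpha>max. 0 \<le> \<alpha>max \<and> \<alpha>max < 1 \<and> (\<forall>k. 0 \<le> \<alpha> k \<and> \<alpha> k \<le> \<alpha>max)"
    and "summable (\<lambda>k. \<alpha> (Suc k) * quad_norm (G_mat l m n A H \<beta>) (w (Suc k) - w k))"
    and "pos_def (n 1) (H 1)"
    and "\<And>j. j \<in> {2..l} \<Longrightarrow>
           pos_def (n j) (H j - (\<beta> * (real l - 2)) \<cdot>\<^sub>m (transpose_mat (A j) * A j))"
  shows "limitin (vec_topology m)
           (\<lambda>k. finsum_vec TYPE(real) m (\<lambda>j. A j *\<^sub>v x k j) {1..l}) c sequentially
       \<and> (\<exists>y. (\<forall>j\<in>{1..l}. y j \<in> X j) \<and>
              finsum_vec TYPE(real) m (\<lambda>j. A j *\<^sub>v y j) {1..l} = c \<and>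
              (\<forall>v. (\<forall>j\<in>{1..l}. v j \<in> X j) \<and>
                   finsum_vec TYPE(real) m (\<lambda>j. A j *\<^sub>v v j) {1..l} = c \<longrightarrow>
                   (\<Sum>j=1..l. f j (y j)) \<le> (\<Sum>j=1..l. f j (v j))) \<and>
              (\<lambda>k. \<Sum>j=1..l. f j (x k j)) \<longlonglongrightarrow> (\<Sum>j=1..l. f j (y j)))
       \<and> (\<exists>ws\<in>kkt_points l m n A c X f.
              limitin (vec_topology ((\<Sum>j=1..l. n j) + m)) w ws sequentially)"
proof -
  note l = assms(1) and A = assms(2) and c = assms(3) and Xcl = assms(4) and X = assms(5)
    and fcl = assms(6) and f = assms(7) and H = assms(8) and \<beta> = assms(9) and iter = assms(10)
  define N where "N = (\<Sum>j=1..l. n j) + m"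
  define G where "G = G_mat l m n A H \<beta>"
  define sad where "sad = saddle_point l m A c X f"
  have w: "w = (\<lambda>k. point l m n (x k) (z k))" using assms(11) by auto
  have wc: "w k \<in> carrier_vec N" for k unfolding w N_def by (rule point_carrier)
  have fe: "feasible_blocks l m X (x k) (z k)" for k
    by (rule iterate_feasible[OF l A c X f H \<beta> iter])
  have fc: "j \<in> {1..l} \<Longrightarrow> v j \<in> carrier_vec (n j)" "\<zeta> \<in> carrier_vec m"
    if "feasible_blocks l m X v \<zeta>" for v \<zeta> j
    by (rule feasible_carrier[OF l A c X f H \<beta> that]; assumption)+
  note xc = fc(1)[OF fe] and zc = fc(2)[OF fe]
  have rc: "residual l m A c u \<in> carrier_vec m" for u by (rule residual_carrier[OF A c])
  have kkt: "kkt_points l m n A c X f = {point l m n xs zs | xs zs. sad xs zs}"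
    unfolding sad_def by (rule kkt_points_eq_saddle_points[OF l A c X f H \<beta>])
  have sad: "sad xs zs \<longleftrightarrow> feasible_blocks l m X xs zs \<and> (\<forall>v \<zeta>. feasible_blocks l m X v \<zeta> \<longrightarrow>
     0 \<le> (\<Sum>j=1..l. f j (v j)) - (\<Sum>j=1..l. f j (xs j))
       + (residual l m A c xs \<bullet> \<zeta> - residual l m A c v \<bullet> zs))" for xs zs
    unfolding sad_def by (rule saddle_point_def)
  have sad_res: "residual l m A c xs = 0\<^sub>v m" if "sad xs zs" for xs zs
    by (rule saddle_point_residual[OF l A c X f H \<beta> that[unfolded sad_def]])
  define e where "e k = w (Suc k) - extrapolate \<alpha> w k" for k
  have ec: "e k \<in> carrier_vec N" for k
    unfolding e_def using wc[of "Suc k"] extrapolate_carrier[of w N \<alpha> k, OF wc] by simp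
  have VI: "0 \<le> (\<Sum>j=1..l. f j (v j)) - (\<Sum>j=1..l. f j (x (Suc k) j))
    + (residual l m A c (x (Suc k)) \<bullet> \<zeta> - residual l m A c v \<bullet> z (Suc k))
    + (point l m n v \<zeta> - w (Suc k)) \<bullet> (G *\<^sub>v e k)"
    if "feasible_blocks l m X v \<zeta>" for v \<zeta> k
    unfolding w e_def G_def
    by (rule proximal_variational_inequality[OF l A c X f H \<beta> iter that])
  have Gpd: "pos_def N G"
    unfolding N_def G_def by (rule G_mat_pos_def[where n = n and A = A and H = H, OF l A H \<beta> assms(15) assms(16)])
  then have Gc: "G \<in> carrier_mat N N" by (simp add: pos_def_def)
  have Gec: "G *\<^sub>v e k \<in> carrier_vec N" for k using Gc ec by (rule mult_mat_vec_carrier)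
  have pc: "point l m n v \<zeta> \<in> carrier_vec N" for v \<zeta> unfolding N_def by (rule point_carrier)
  obtain a where a: "a < 1" "\<And>k. 0 \<le> \<alpha> k" "\<And>k. \<alpha> k \<le> a" using assms(13) by blast
  have cross_lim: "(\<lambda>i. (p - w (Suc (r i))) \<bullet> (G *\<^sub>v e (r i))) \<longlonglongrightarrow> 0"
    if p: "p \<in> carrier_vec N" and w_lim: "limitin (vec_topology N) (\<lambda>i. w (Suc (r i))) s sequentially"
      and e_lim: "limitin (vec_topology N) (\<lambda>i. e (r i)) (0\<^sub>v N) sequentially" for r p s
  proof -
    have s: "s \<in> carrier_vec N" using w_lim by (rule limitin_vec_carrier)
    have "(\<lambda>i. (p - w (Suc (r i))) \<bullet> (G *\<^sub>v e (r i))) \<longlonglongrightarrow> (p - s) \<bullet> (G *\<^sub>v 0\<^sub>v N)"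
      by (rule tendsto_scalar_prod_vec[OF _ Gec limitin_vec_minus[OF p wc limitin_vec_const[OF p] w_lim]
            limitin_mult_mat_vec[OF Gc ec e_lim]]) (use p wc in auto)
    moreover have "G *\<^sub>v 0\<^sub>v N = 0\<^sub>v N" using Gc by (intro eq_vecI) auto
    ultimately show ?thesis using p s by simp
  qed
  have block_lim: "limitin (vec_topology (n j)) (\<lambda>i. x (r i) j) (xs j) sequentially"
    if "limitin (vec_topology N) (\<lambda>i. w (r i)) (point l m n xs zs) sequentially"
      "\<And>j. j \<in> {1..l} \<Longrightarrow> xs j \<in> carrier_vec (n j)" "zs \<in> carrier_vec m" "j \<in> {1..l}" for r :: "nat \<Rightarrow> nat" and xs zs j
    by (rule limitin_point_blocks(1)[where x = "\<lambda>i. x (r i)" and z = "\<lambda>i. z (r i)" and t = zs and l = l and m = m,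
          OF xc zc that(2,3) that(1)[unfolded w N_def] that(4)])
  have mult_lim: "limitin (vec_topology m) (\<lambda>i. z (r i)) zs sequentially"
    if "limitin (vec_topology N) (\<lambda>i. w (r i)) (point l m n xs zs) sequentially"
      "\<And>j. j \<in> {1..l} \<Longrightarrow> xs j \<in> carrier_vec (n j)" "zs \<in> carrier_vec m" for r :: "nat \<Rightarrow> nat" and xs zs
    by (rule limitin_point_blocks(2)[where x = "\<lambda>i. x (r i)" and z = "\<lambda>i. z (r i)" and y = xs and l = l and m = m,
          OF xc zc that(2,3) that(1)[unfolded w N_def]])
  obtain s where s: "s \<in> kkt_points l m n A c X f" and w_lim: "limitin (vec_topology N) w s sequentially"
    and e_lim: "limitin (vec_topology N) (\<lambda>k. w (Suc k) - extrapolate \<alpha> w k) (0\<^sub>v N) sequentially"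
  proof (rule inertial_fejer_convergence[OF Gpd wc a(2) a(3) a(1)])
    show "kkt_points l m n A c X f \<subseteq> carrier_vec N" unfolding kkt using pc by auto
    show "kkt_points l m n A c X f \<noteq> {}" by (rule assms(12))
    show "summable (\<lambda>k. \<alpha> (Suc k) * quad_norm G (w (Suc k) - w k))"
      unfolding G_def by (rule assms(14))
    show "(w (Suc k) - s) \<bullet> (G *\<^sub>v (w (Suc k) - extrapolate \<alpha> w k)) \<le> 0"
      if sk: "s \<in> kkt_points l m n A c X f" for s k
    proof -
      obtain xs zs where s: "s = point l m n xs zs" and ss: "sad xs zs" using sk unfolding kkt by auto
      have sc: "s \<in> carrier_vec N" unfolding s by (rule pc)
      have "0 \<le> (\<Sum>j=1..l. f j (x (Suc k) j)) - (\<Sum>j=1..l. f j (xs j))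
          + (residual l m A c xs \<bullet> z (Suc k) - residual l m A c (x (Suc k)) \<bullet> zs)"
        using ss fe unfolding sad by blast
      moreover have "feasible_blocks l m X xs zs" using ss unfolding sad by blast
      from VI[OF this, of k] have "0 \<le> (\<Sum>j=1..l. f j (xs j)) - (\<Sum>j=1..l. f j (x (Suc k) j))
        + (residual l m A c (x (Suc k)) \<bullet> zs - residual l m A c xs \<bullet> z (Suc k))
        + (s - w (Suc k)) \<bullet> (G *\<^sub>v e k)" unfolding s .
      ultimately have "0 \<le> (s - w (Suc k)) \<bullet> (G *\<^sub>v e k)" by linarith
      moreover have "(w (Suc k) - s) \<bullet> (G *\<^sub>v e k) = - ((s - w (Suc k)) \<bullet> (G *\<^sub>v e k))"
        unfolding minus_scalar_prod_distrib[OF wc sc Gec] minus_scalar_prod_distrib[OF sc wc Gec] by simp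
      ultimately show ?thesis unfolding e_def by linarith
    qed
    show "s \<in> kkt_points l m n A c X f"
      if r: "strict_mono r" and w_lim: "limitin (vec_topology N) (\<lambda>i. w (Suc (r i))) s sequentially"
        and e_lim: "limitin (vec_topology N) (\<lambda>i. w (Suc (r i)) - extrapolate \<alpha> w (r i)) (0\<^sub>v N) sequentially"
      for r s
    proof -
      have "s \<in> carrier_vec N" using w_lim by (rule limitin_vec_carrier)
      from point_surj[OF this[unfolded N_def]] obtain xs zs where xs: "\<And>j. j \<in> {1..l} \<Longrightarrow> xs j \<in> carrier_vec (n j)"
        and zs: "zs \<in> carrier_vec m" and s: "s = point l m n xs zs"
        by metis
      have x_lim: "limitin (vec_topology (n j)) (\<lambda>i. x (Suc (r i)) j) (xs j) sequentially"
        if "j \<in> {1..l}" for j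
        by (rule block_lim[where r = "\<lambda>i. Suc (r i)", OF w_lim[unfolded s] xs zs that])
      have z_lim: "limitin (vec_topology m) (\<lambda>i. z (Suc (r i))) zs sequentially"
        by (rule mult_lim[where r = "\<lambda>i. Suc (r i)", OF w_lim[unfolded s] xs zs])
      have r_lim: "limitin (vec_topology m) (\<lambda>i. residual l m A c (x (Suc (r i)))) (residual l m A c xs) sequentially"
        by (rule limitin_residual[OF A c xc x_lim])
      have "xs j \<in> X j" if j: "j \<in> {1..l}" for j
      proof (rule limitin_closedin[OF x_lim[OF j] Xcl[OF j]])
        show "\<forall>\<^sub>F i in sequentially. x (Suc (r i)) j \<in> X j"
          using fe j by (auto simp: feasible_blocks_def)
      qed simp
      then have fes: "feasible_blocks l m X xs zs" using zs by (simp add: feasible_blocks_def)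
      \<comment> \<open>Pass to the limit in the proximal inequality. On the left, lower semicontinuity suffices.\<close>
      have "(\<Sum>j=1..l. f j (xs j)) \<le> (\<Sum>j=1..l. f j (v j))
          + (residual l m A c xs \<bullet> \<zeta> - residual l m A c v \<bullet> zs) + 0"
        if fev: "feasible_blocks l m X v \<zeta>" for v \<zeta>
      proof (rule closed_vec_fun_sum_le_limit[where n = n and x = "\<lambda>i. x (Suc (r i))", OF fcl xc x_lim])
        show "(\<Sum>j=1..l. f j (x (Suc (r i)) j)) \<le> (\<Sum>j=1..l. f j (v j))
          + (residual l m A c (x (Suc (r i))) \<bullet> \<zeta> - residual l m A c v \<bullet> z (Suc (r i)))
          + (point l m n v \<zeta> - w (Suc (r i))) \<bullet> (G *\<^sub>v e (r i))" for i
          using VI[OF fev, of "r i"] by linarith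
        show "(\<lambda>i. (\<Sum>j=1..l. f j (v j))
          + (residual l m A c (x (Suc (r i))) \<bullet> \<zeta> - residual l m A c v \<bullet> z (Suc (r i)))
          + (point l m n v \<zeta> - w (Suc (r i))) \<bullet> (G *\<^sub>v e (r i)))
          \<longlonglongrightarrow> (\<Sum>j=1..l. f j (v j)) + (residual l m A c xs \<bullet> \<zeta> - residual l m A c v \<bullet> zs) + 0"
          by (intro tendsto_add tendsto_diff tendsto_const
              tendsto_scalar_prod_vec[OF rc fc(2)[OF fev] r_lim limitin_vec_const[OF fc(2)[OF fev]]]
              tendsto_scalar_prod_vec[OF rc zc limitin_vec_const[OF rc] z_lim]
              cross_lim[OF pc w_lim e_lim[folded e_def]])
      qed
      then have "sad xs zs" using fes unfolding sad by force
      then show ?thesis unfolding kkt s by blast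
    qed
  qed
  obtain xs zs where s_eq: "s = point l m n xs zs" and ss: "sad xs zs" using s unfolding kkt by auto
  have fes: "feasible_blocks l m X xs zs" using ss unfolding sad by blast
  note xsc = fc(1)[OF fes] and zsc = fc(2)[OF fes]
  have res: "residual l m A c xs = 0\<^sub>v m" using ss by (rule sad_res)
  have x_lim: "limitin (vec_topology (n j)) (\<lambda>k. x k j) (xs j) sequentially" if "j \<in> {1..l}" for j
    by (rule block_lim[where r = "\<lambda>k. k", OF w_lim[unfolded s_eq] xsc zsc that])
  have z_lim: "limitin (vec_topology m) z zs sequentially"
    by (rule mult_lim[where r = "\<lambda>k. k", OF w_lim[unfolded s_eq] xsc zsc])
  have r_lim: "limitin (vec_topology m) (\<lambda>k. residual l m A c (x k)) (0\<^sub>v m) sequentially"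
    unfolding res[symmetric] by (rule limitin_residual[OF A c xc x_lim])
  define S where "S v = finsum_vec TYPE(real) m (\<lambda>j. A j *\<^sub>v v j) {1..l}" for v
  have Sc: "S v \<in> carrier_vec m" for v
    unfolding S_def using A by (intro finsum_vec_carrier carrier_vecI) auto
  have S_res: "S v = residual l m A c v + c" for v
    using Sc[of v] c unfolding residual_def S_def[symmetric] by (intro eq_vecI) auto
  have part1: "limitin (vec_topology m) (\<lambda>k. S (x k)) c sequentially"
  proof -
    have "(\<lambda>k. S (x k) $ i) \<longlonglongrightarrow> c $ i" if i: "i < m" for i
    proof -
      have "(\<lambda>k. residual l m A c (x k) $ i) \<longlonglongrightarrow> 0\<^sub>v m $ i"
        using r_lim rc i by (rule limitin_vec_index)
      then have "(\<lambda>k. residual l m A c (x k) $ i + c $ i) \<longlonglongrightarrow> 0 + c $ i"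
        using i by (intro tendsto_intros) simp
      then show ?thesis unfolding S_res using i c by simp
    qed
    then show ?thesis using Sc c by (subst limitin_vec_iff) auto
  qed
  have Sxs: "S xs = c" unfolding S_res res using c by simp
  have opt: "(\<Sum>j=1..l. f j (xs j)) \<le> (\<Sum>j=1..l. f j (v j))"
    if v: "\<forall>j\<in>{1..l}. v j \<in> X j" "S v = c" for v
  proof -
    have "feasible_blocks l m X v zs" using v(1) zsc by (simp add: feasible_blocks_def)
    then have "0 \<le> (\<Sum>j=1..l. f j (v j)) - (\<Sum>j=1..l. f j (xs j))
       + (residual l m A c xs \<bullet> zs - residual l m A c v \<bullet> zs)" using ss unfolding sad by blast
    moreover have "residual l m A c v = 0\<^sub>v m"
      unfolding residual_def S_def[symmetric] v(2) using c by simp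
    ultimately show ?thesis using res by simp
  qed
  \<comment> \<open>Below, the saddle point inequality tested with the iterate; above, the proximal inequality tested with the saddle point.\<close>
  have "(\<lambda>k. \<Sum>j=1..l. f j (x (Suc k) j)) \<longlonglongrightarrow> (\<Sum>j=1..l. f j (xs j))"
  proof (rule tendsto_sandwich)
    have w_lim': "limitin (vec_topology N) (\<lambda>k. w (Suc k)) s sequentially"
      using limitin_sequentially_offset[OF w_lim, of 1] by simp
    have r_lim': "limitin (vec_topology m) (\<lambda>k. residual l m A c (x (Suc k))) (0\<^sub>v m) sequentially"
      using limitin_sequentially_offset[OF r_lim, of 1] by simp
    have rz: "(\<lambda>k. residual l m A c (x (Suc k)) \<bullet> zs) \<longlonglongrightarrow> 0"
      using tendsto_scalar_prod_vec[OF rc zsc r_lim' limitin_vec_const[OF zsc]] zsc by simp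
    show "(\<lambda>k. (\<Sum>j=1..l. f j (xs j)) + residual l m A c (x (Suc k)) \<bullet> zs) \<longlonglongrightarrow> (\<Sum>j=1..l. f j (xs j))"
      using tendsto_add[OF tendsto_const rz] by simp
    show "(\<lambda>k. (\<Sum>j=1..l. f j (xs j)) + residual l m A c (x (Suc k)) \<bullet> zs
        + (s - w (Suc k)) \<bullet> (G *\<^sub>v e k)) \<longlonglongrightarrow> (\<Sum>j=1..l. f j (xs j))"
      using tendsto_add[OF tendsto_add[OF tendsto_const rz]
          cross_lim[where r = "\<lambda>k. k", OF pc[of xs zs, folded s_eq] w_lim' e_lim[folded e_def]]] by simp
    have z0: "residual l m A c xs \<bullet> z k = 0" for k unfolding res using zc by simp
    show "\<forall>\<^sub>F k in sequentially. (\<Sum>j=1..l. f j (xs j)) + residual l m A c (x (Suc k)) \<bullet> zs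
        \<le> (\<Sum>j=1..l. f j (x (Suc k) j))"
    proof (intro always_eventually allI)
      fix k
      have "0 \<le> (\<Sum>j=1..l. f j (x (Suc k) j)) - (\<Sum>j=1..l. f j (xs j))
          + (residual l m A c xs \<bullet> z (Suc k) - residual l m A c (x (Suc k)) \<bullet> zs)"
        using ss fe unfolding sad by blast
      then show "(\<Sum>j=1..l. f j (xs j)) + residual l m A c (x (Suc k)) \<bullet> zs
        \<le> (\<Sum>j=1..l. f j (x (Suc k) j))" using z0[of "Suc k"] by linarith
    qed
    show "\<forall>\<^sub>F k in sequentially. (\<Sum>j=1..l. f j (x (Suc k) j))
        \<le> (\<Sum>j=1..l. f j (xs j)) + residual l m A c (x (Suc k)) \<bullet> zs + (s - w (Suc k)) \<bullet> (G *\<^sub>v e k)"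
    proof (intro always_eventually allI)
      fix k
      show "(\<Sum>j=1..l. f j (x (Suc k) j))
        \<le> (\<Sum>j=1..l. f j (xs j)) + residual l m A c (x (Suc k)) \<bullet> zs + (s - w (Suc k)) \<bullet> (G *\<^sub>v e k)"
        using VI[OF fes, of k] z0[of "Suc k"] unfolding s_eq by linarith
    qed
  qed
  then have part2: "(\<lambda>k. \<Sum>j=1..l. f j (x k j)) \<longlonglongrightarrow> (\<Sum>j=1..l. f j (xs j))"
    by (rule LIMSEQ_imp_Suc)
  have "\<forall>j\<in>{1..l}. xs j \<in> X j" using fes by (simp add: feasible_blocks_def)
  then show ?thesis
    using part1 Sxs opt part2 s w_lim unfolding S_def N_def by blast
qed

end
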